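(* Let $s\ge 2$ be the alphabet size, let $\kappa_s = 5\frac{\sqrt{s}}{\ln s}$, and let $\vec r=\{r_m\}_{m\ge1}$ be any content (with $0\le r_m\le s^m$, not all zero) whose minimal word length $m_{\min}$ satisfies $m_{\min}\ge 2$. Then the complexity of the multiple pattern matching problem on an alphabet of size $s$ satisfies \[ \frac{1}{\kappa_s}\left(\phi(\vec r)+\frac{1}{2s\,m_{\min}}\right)\le \Phi_{\rm aver}(\vec r)\le \Phi_{\rm max}(\vec r)\le 2\left(\phi(\vec r)+\frac{1}{2s\,m_{\min}}\right). \]
   Context: Let $\Sigma$ be an alphabet of $s$ symbols. A dictionary $D$ is a (finite or infinite) collection of nonempty words over $\Sigma$; its content is $\vec r(D)=\{r_m(D)\}_{m\ge1}$, where $r_m(D)$ is the number of words of length $m$ in $D$, and $m_{\min}$ is the smallest $m$ with $r_m>0$. A word $w$ occurs in a text $\xi=(\xi_1,\dots,\xi_n)\in\Sigma^n$ at position $j$ if $w=\xi_j\xi_{j+1}\cdots\xi_{j+|w|-1}$. The multiple pattern matching problem (MPMP) for $(D,\xi)$ asks for the set of all (position, word) pairs of occurrences of words of $D$ in $\xi$. Complexity is measured by the number of characters of $\xi$ accessed: an algorithm adaptively (possibly randomly) chooses positions of $\xi$ to read, based on $D$ and the characters read so far, and stops when the characters read determine the output. For $\xi$ uniform in $\Sigma^n$, $\Phi(D)$ is defined by: $\Phi(D)/\ln s=\lim_{n\to\infty}\frac1n\,\min_{\text{algorithms}}\mathbb{E}_\xi[\#\text{characters read}]$ (the limit exists). For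 a content $\vec r$, $\Phi_{\rm aver}(\vec r)=\mathbb{E}_D\,\Phi(D)$, where $D$ consists of $r_m$ words of length $m$ for each $m$, each chosen independently and uniformly in $\Sigma^m$ (repetitions allowed), and $\Phi_{\rm max}(\vec r)=\max_{D:\vec r(D)=\vec r}\Phi(D)$. Finally $\phi(\vec r)=\max_{m:\,r_m\ge1}\frac1m\ln(s\,m\,r_m)$. Natural logarithms are used throughout. *)

theory Defs
  imports "HOL-Probability.Probability"
begin

text \<open>
  The alphabet is a type of class \<^class>\<open>finite\<close>; its size \<open>s\<close> is \<open>CARD('a)\<close>.
  Words and texts are lists, and positions in a text are counted from 0.
\<close>

definition words :: "nat \<Rightarrow> 'a::finite list set" where
  "words m = {w. length w = m}"

definition dictionary :: "'a::finite list set \<Rightarrow> bool" where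
  "dictionary D \<longleftrightarrow> [] \<notin> D"

definition content :: "'a::finite list set \<Rightarrow> nat \<Rightarrow> nat" where
  "content D m = card {w \<in> D. length w = m}"

definition m_min :: "(nat \<Rightarrow> nat) \<Rightarrow> nat" where
  "m_min r = (LEAST m. r m > 0)"

definition occurs_at :: "'a::finite list \<Rightarrow> 'a list \<Rightarrow> nat \<Rightarrow> bool" where
  "occurs_at w \<xi> j \<longleftrightarrow> j + length w \<le> length \<xi> \<and> take (length w) (drop j \<xi>) = w"

definition mpmp :: "'a::finite list set \<Rightarrow> 'a list \<Rightarrow> (nat \<times> 'a list) set" where
  "mpmp D \<xi> = {(j, w). w \<in> D \<and> occurs_at w \<xi> j}"

text \<open>
  A partial map \<open>K\<close> records the characters read so far. They determine the output if it is
  the same for all texts of length \<open>n\<close> that agree with them.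
\<close>

definition agrees :: "(nat \<rightharpoonup> 'a::finite) \<Rightarrow> 'a list \<Rightarrow> bool" where
  "agrees K \<xi> \<longleftrightarrow> (\<forall>j \<in> dom K. K j = Some (\<xi> ! j))"

definition determined :: "nat \<Rightarrow> 'a::finite list set \<Rightarrow> (nat \<rightharpoonup> 'a) \<Rightarrow> bool" where
  "determined n D K \<longleftrightarrow>
     (\<forall>\<xi> \<in> words n. \<forall>\<eta> \<in> words n. agrees K \<xi> \<longrightarrow> agrees K \<eta> \<longrightarrow> mpmp D \<xi> = mpmp D \<eta>)"

text \<open>
  In \<open>Read p f\<close> the next position \<open>j\<close> is drawn from \<open>p\<close>, the character \<open>c\<close> at \<open>j\<close> is read, and
  the algorithm continues with \<open>f j c\<close>. Deterministic choices are point masses \<open>p\<close>.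
\<close>

datatype 'a algorithm = Stop | Read "nat pmf" "nat \<Rightarrow> 'a \<Rightarrow> 'a algorithm"

text \<open>
  The algorithm reads new positions only, and it stops exactly when the characters read
  determine the output.
\<close>

primrec solves_from ::
    "nat \<Rightarrow> 'a::finite list set \<Rightarrow> 'a algorithm \<Rightarrow> (nat \<rightharpoonup> 'a) \<Rightarrow> bool" where
  "solves_from n D Stop K \<longleftrightarrow> determined n D K"
| "solves_from n D (Read p f) K \<longleftrightarrow>
     \<not> determined n D K \<and> set_pmf p \<subseteq> {..<n} - dom K \<and>
     (\<forall>j \<in> set_pmf p. \<forall>c. solves_from n D (f j c) (K(j \<mapsto> c)))"

definition solves :: "nat \<Rightarrow> 'a::finite list set \<Rightarrow> 'a algorithm \<Rightarrow> bool" where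
  "solves n D A \<longleftrightarrow> solves_from n D A Map.empty"

text \<open>The expectation here is over the random choices of the algorithm only.\<close>

primrec expected_reads :: "'a::finite algorithm \<Rightarrow> 'a list \<Rightarrow> real" where
  "expected_reads Stop \<xi> = 0"
| "expected_reads (Read p f) \<xi> =
     1 + measure_pmf.expectation p (\<lambda>j. expected_reads (f j (\<xi> ! j)) \<xi>)"

definition min_reads :: "nat \<Rightarrow> 'a::finite list set \<Rightarrow> real" where
  "min_reads n D =
     (INF A \<in> {A. solves n D A}. measure_pmf.expectation (pmf_of_set (words n)) (expected_reads A))"

definition Phi :: "'a::finite list set \<Rightarrow> real" where
  "Phi D = ln (real CARD('a)) * lim (\<lambda>n. min_reads n D / real n)"

text \<open>
  A random dictionary of content \<open>r\<close>: one independent uniform word of length \<open>m\<close> for every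
  \<open>(m, i)\<close> with \<open>i < r m\<close>. A repeated word occurs just once in the resulting set, which does not
  affect the complexity.
\<close>

definition slots :: "(nat \<Rightarrow> nat) \<Rightarrow> (nat \<times> nat) set" where
  "slots r = {(m, i). i < r m}"

definition random_words :: "(nat \<Rightarrow> nat) \<Rightarrow> (nat \<times> nat \<Rightarrow> 'a::finite list) measure" where
  "random_words r = Pi\<^sub>M (slots r) (\<lambda>(m, i). uniform_count_measure (words m))"

definition Phi_aver :: "'a::finite itself \<Rightarrow> (nat \<Rightarrow> nat) \<Rightarrow> real" where
  "Phi_aver _ r = (\<integral>\<omega>. Phi (\<omega> ` slots r) \<partial>(random_words r :: (nat \<times> nat \<Rightarrow> 'a list) measure))"

definition Phi_max :: "'a::finite itself \<Rightarrow> (nat \<Rightarrow> nat) \<Rightarrow> real" where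
  "Phi_max _ r = (SUP D \<in> {D :: 'a list set. dictionary D \<and> content D = r}. Phi D)"

text \<open>A supremum, since infinitely many lengths may occur.\<close>

definition phi :: "nat \<Rightarrow> (nat \<Rightarrow> nat) \<Rightarrow> real" where
  "phi s r = (SUP m \<in> {m. r m \<ge> 1}. 1 / real m * ln (real s * real m * real (r m)))"

definition kappa :: "nat \<Rightarrow> real" where
  "kappa s = 5 * (sqrt (real s) / ln (real s))"

end

theory Submission
  imports Defs
begin

text \<open>
  The optimal expected number of reads satisfies a dynamic program over partial texts. It is
  superadditive in the length of the text, so the limit defining \<open>\<Phi>\<close> is a supremum: every fixed
  length gives a lower bound.

  Upper bound: read positions with density \<open>\<alpha> = 2 t / ln s\<close> for some \<open>t\<close> slightly above \<open>\<phi>\<close>, then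
  check the surviving placements character by character. A word of length \<open>m\<close> survives at a given
  place with probability about \<open>s\<^sup>-\<^sup>\<alpha>\<^sup>m\<close>, which beats the bound \<open>e\<^sup>t\<^sup>m / (s m)\<close> on the number of
  such words. Averaging over the phase of the sampling keeps the rounding of \<open>\<alpha> m\<close> from costing a
  factor \<open>s\<close>.

  Lower bound (after Yao): fix one length \<open>m\<close>. A set of \<open>l\<close> positions certifies a text of length
  \<open>3m/2\<close> only if each of the \<open>r\<^sub>m\<close> random words disagrees with the text on it at all \<open>m/2\<close> places.
  At least \<open>m / (2 l\<^sup>2)\<close> of these places constrain disjoint parts of the word, so a given set
  certifies with probability at most \<open>exp (- m r\<^sub>m / (2 l\<^sup>2 s\<^sup>l))\<close>, and a union bound over the sets
  shows that about \<open>ln (s m r\<^sub>m)\<close> reads are needed. When this quantity is small, already the first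
  two reads suffice.
\<close>

text \<open>The factor 2 of the upper bound splits evenly. At density \<open>2 t / ln s\<close> a
  word of length m survives with probability about e^(-2tm), and at most e^(tm)/(s m) words have
  this length; the product leaves e^(-tm)/m, whose sum over m is geometric. The shortest length
  dominates, and there e^(-tm) is at most 1/(s m) by the same count. This produces the additive term
  1/(2 s m_min). The square root in \<open>kappa\<close> comes from the lower bound. Put \<Lambda> =
  ln(s m r_m) and A about 1/(5 sqrt s); certificates of size l about 9/5 A \<Lambda> are to be
  excluded. The exponent m r_m / (2 l^2 s^l) equals e^\<Lambda> / (2 s l^2 s^l). Since s A^2 is
  bounded, s l^2 is at most a multiple of \<Lambda>^2 uniformly in s; since ln s / sqrt s is
  bounded, s^l costs only a fixed fraction of \<Lambda>. What remains is exponential in \<Lambda>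
  and has to beat only the polynomial l ln n of the union bound. Infinite dictionaries cause no
  trouble: a text of length n sees only words of length at most n.\<close>

section \<open>The optimal expected cost as a dynamic program\<close>

text \<open>\<open>u\<close> is fuel: the number of positions not yet read.\<close>

primrec cost_fuel :: "nat \<Rightarrow> 'a::finite list set \<Rightarrow> nat \<Rightarrow> (nat \<rightharpoonup> 'a) \<Rightarrow> real" where
  "cost_fuel n D 0 K = 0"
| "cost_fuel n D (Suc u) K =
     (if determined n D K then 0
      else 1 + (MIN j\<in>{..<n} - dom K. (\<Sum>c\<in>UNIV. cost_fuel n D u (K(j \<mapsto> c))) / real CARD('a)))"

definition cost :: "nat \<Rightarrow> 'a::finite list set \<Rightarrow> (nat \<rightharpoonup> 'a) \<Rightarrow> real" where
  "cost n D K = cost_fuel n D (card ({..<n} - dom K)) K"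

lemma agrees_empty [simp]: "agrees Map.empty \<xi>"
  by (simp add: agrees_def)

lemma agrees_iff: "agrees K \<xi> \<longleftrightarrow> (\<forall>j c. K j = Some c \<longrightarrow> \<xi> ! j = c)"
proof
  assume a: "agrees K \<xi>"
  show "\<forall>j c. K j = Some c \<longrightarrow> \<xi> ! j = c"
  proof (intro allI impI)
    fix j c assume "K j = Some c"
    moreover from this have "K j = Some (\<xi> ! j)" using a unfolding agrees_def by blast
    ultimately show "\<xi> ! j = c" by simp
  qed
next
  assume "\<forall>j c. K j = Some c \<longrightarrow> \<xi> ! j = c"
  then show "agrees K \<xi>" unfolding agrees_def by fastforce
qed

lemma agrees_upd: "j \<notin> dom K \<Longrightarrow> agrees (K(j \<mapsto> c)) \<xi> \<longleftrightarrow> agrees K \<xi> \<and> \<xi> ! j = c"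
  by (auto simp: agrees_iff domIff)

lemma card_unread_upd:
  fixes K :: "nat \<rightharpoonup> 'a"
  assumes "j \<in> {..<n} - dom K"
  shows "card ({..<n} - dom K) = Suc (card ({..<n} - dom (K(j \<mapsto> c))))"
proof -
  have "{..<n} - dom (K(j \<mapsto> c)) = ({..<n} - dom K) - {j}" by (simp only: dom_fun_upd) (simp, blast)
  then show ?thesis using card_Suc_Diff1[OF _ assms] by (simp only: finite_Diff finite_lessThan)
qed

text \<open>Well-founded since a read lowers the number of unread positions below \<open>n\<close>.
  With this scheme and \<open>cost_unfold\<close> the fuel no longer appears.\<close>

lemma unread_induct [case_names step]:
  fixes K :: "nat \<rightharpoonup> 'a"
  assumes "\<And>K. (\<And>j c. j \<in> {..<n} - dom K \<Longrightarrow> P (K(j \<mapsto> c))) \<Longrightarrow> P K"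
  shows "P K"
proof (induction "card ({..<n} - dom K)" arbitrary: K rule: less_induct)
  case less
  show ?case
  proof (rule assms)
    fix j c assume j: "j \<in> {..<n} - dom K"
    show "P (K(j \<mapsto> c))" by (rule less) (use card_unread_upd[OF j, of c] in simp)
  qed
qed

lemma full_determined: "{..<n} \<subseteq> dom K \<Longrightarrow> determined n D K"
  unfolding determined_def
proof (intro ballI impI)
  fix \<xi> \<eta> assume d: "{..<n} \<subseteq> dom K" and w: "\<xi> \<in> words n" "\<eta> \<in> words n"
    and a: "agrees K \<xi>" "agrees K \<eta>"
  have "\<xi> = \<eta>"
  proof (rule nth_equalityI)
    show "length \<xi> = length \<eta>" using w by (simp add: words_def)
    fix i assume "i < length \<xi>"
    then have "i \<in> dom K" using d w by (auto simp: words_def)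
    then show "\<xi> ! i = \<eta> ! i" using a unfolding agrees_def by (metis option.inject)
  qed
  then show "mpmp D \<xi> = mpmp D \<eta>" by simp
qed

lemma unread_nonempty: "\<not> determined n D K \<Longrightarrow> {..<n} - dom K \<noteq> {}"
  using full_determined by blast

lemma cost_fuel_determined: "determined n D K \<Longrightarrow> cost_fuel n D u K = 0"
  by (cases u) auto

lemma cost_determined: "determined n D K \<Longrightarrow> cost n D K = 0"
  by (simp add: cost_def cost_fuel_determined)

lemma cost_unfold:
  fixes K :: "nat \<rightharpoonup> 'a::finite"
  assumes "\<not> determined n D K"
  shows "cost n D K =
    1 + (MIN j\<in>{..<n} - dom K. (\<Sum>c\<in>UNIV. cost n D (K(j \<mapsto> c))) / real CARD('a))"
proof -
  have "card ({..<n} - dom K) \<noteq> 0" using unread_nonempty[OF assms] by simp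
  then obtain u where u: "card ({..<n} - dom K) = Suc u" using not0_implies_Suc by blast
  have "(\<lambda>j. (\<Sum>c\<in>UNIV. cost_fuel n D u (K(j \<mapsto> c))) / real CARD('a)) ` ({..<n} - dom K)
      = (\<lambda>j. (\<Sum>c\<in>UNIV. cost n D (K(j \<mapsto> c))) / real CARD('a)) ` ({..<n} - dom K)"
  proof (rule image_cong[OF refl])
    fix j assume j: "j \<in> {..<n} - dom K"
    have "cost n D (K(j \<mapsto> c)) = cost_fuel n D u (K(j \<mapsto> c))" for c
      using card_unread_upd[OF j, of c] u by (simp add: cost_def del: dom_fun_upd)
    then show "(\<Sum>c\<in>UNIV. cost_fuel n D u (K(j \<mapsto> c))) / real CARD('a)
      = (\<Sum>c\<in>UNIV. cost n D (K(j \<mapsto> c))) / real CARD('a)" by simp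
  qed
  then show ?thesis using u assms by (simp add: cost_def del: dom_fun_upd)
qed

lemma cost_attained:
  fixes K :: "nat \<rightharpoonup> 'a::finite"
  assumes "\<not> determined n D K"
  obtains j where "j \<in> {..<n} - dom K"
    "cost n D K = 1 + (\<Sum>c\<in>UNIV. cost n D (K(j \<mapsto> c))) / real CARD('a)"
proof -
  let ?g = "\<lambda>j. (\<Sum>c\<in>UNIV. cost n D (K(j \<mapsto> c))) / real CARD('a)"
  have "Min (?g ` ({..<n} - dom K)) \<in> ?g ` ({..<n} - dom K)"
    using unread_nonempty[OF assms] by (intro Min_in) auto
  then show ?thesis using that cost_unfold[OF assms] by auto
qed

lemma cost_nonneg: "0 \<le> cost n D K"
proof (induction K rule: unread_induct[where n = n])
  case (step K)
  show ?case
  proof (cases "determined n D K")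
    case False
    then obtain j where "j \<in> {..<n} - dom K"
      "cost n D K = 1 + (\<Sum>c\<in>UNIV. cost n D (K(j \<mapsto> c))) / real CARD('a)"
      by (rule cost_attained)
    moreover from this(1) have "0 \<le> cost n D (K(j \<mapsto> c))" for c by (rule step)
    ultimately show ?thesis by (simp add: sum_nonneg)
  qed (simp add: cost_determined)
qed

lemma cost_le_read:
  fixes K :: "nat \<rightharpoonup> 'a::finite"
  assumes "j \<in> {..<n} - dom K"
  shows "cost n D K \<le> 1 + (\<Sum>c\<in>UNIV. cost n D (K(j \<mapsto> c))) / real CARD('a)"
proof (cases "determined n D K")
  case True
  then show ?thesis
    by (auto simp: cost_determined cost_nonneg
        intro!: add_nonneg_nonneg divide_nonneg_nonneg sum_nonneg)
next
  case False
  show ?thesis unfolding cost_unfold[OF False] using assms by (intro add_left_mono Min_le) auto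
qed

text \<open>Verification principle behind the upper bounds: if some read always lowers the potential
  by at least 1 on average, following these reads costs no more than the initial potential.\<close>

lemma cost_le_potential:
  fixes f :: "(nat \<rightharpoonup> 'a::finite) \<Rightarrow> real"
  assumes "\<And>K. 0 \<le> f K"
    and "\<And>K. \<not> determined n D K \<Longrightarrow>
      \<exists>j \<in> {..<n} - dom K. 1 + (\<Sum>c\<in>UNIV. f (K(j \<mapsto> c))) / real CARD('a) \<le> f K"
  shows "cost n D K \<le> f K"
proof (induction K rule: unread_induct[where n = n])
  case (step K)
  show ?case
  proof (cases "determined n D K")
    case True
    then show ?thesis by (simp add: cost_determined assms(1))
  next
    case False
    then obtain j where j: "j \<in> {..<n} - dom K"
      "1 + (\<Sum>c\<in>UNIV. f (K(j \<mapsto> c))) / real CARD('a) \<le> f K" using assms(2) by blast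
    have "cost n D K \<le> 1 + (\<Sum>c\<in>UNIV. cost n D (K(j \<mapsto> c))) / real CARD('a)"
      by (rule cost_le_read[OF j(1)])
    also have "\<dots> \<le> 1 + (\<Sum>c\<in>UNIV. f (K(j \<mapsto> c))) / real CARD('a)"
      by (intro add_left_mono divide_right_mono sum_mono step[OF j(1)]) simp
    finally show ?thesis using j(2) by linarith
  qed
qed

lemma cost_le_length: "cost n D Map.empty \<le> real n"
proof -
  let ?f = "\<lambda>K :: nat \<rightharpoonup> 'a. real (card ({..<n} - dom K))"
  have "cost n D Map.empty \<le> ?f Map.empty"
  proof (rule cost_le_potential)
    fix K :: "nat \<rightharpoonup> 'a" assume "\<not> determined n D K"
    then obtain j where j: "j \<in> {..<n} - dom K" using unread_nonempty by blast
    have "?f (K(j \<mapsto> c)) = ?f K - 1" for c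
      unfolding card_unread_upd[OF j, of c] by simp
    then have "1 + (\<Sum>c\<in>UNIV. ?f (K(j \<mapsto> c))) / real CARD('a)
        = 1 + (\<Sum>c\<in>(UNIV :: 'a set). ?f K - 1) / real CARD('a)"
      by (simp only:)
    also have "\<dots> = ?f K" by simp
    finally have "1 + (\<Sum>c\<in>UNIV. ?f (K(j \<mapsto> c))) / real CARD('a) = ?f K" .
    then show "\<exists>j\<in>{..<n} - dom K. 1 + (\<Sum>c\<in>UNIV. ?f (K(j \<mapsto> c))) / real CARD('a) \<le> ?f K"
      by (intro bexI[OF eq_refl j])
  qed (rule of_nat_0_le_iff)
  then show ?thesis by simp
qed

text \<open>The potential is the cost for \<open>D'\<close> itself: an optimal strategy for
  \<open>D'\<close> is followed until \<open>D\<close> is determined.\<close>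

lemma cost_mono_determined:
  fixes D D' :: "'a::finite list set"
  assumes "\<And>K. determined n D' K \<Longrightarrow> determined n D K"
  shows "cost n D K \<le> cost n D' K"
proof (rule cost_le_potential)
  fix K :: "nat \<rightharpoonup> 'a" assume "\<not> determined n D K"
  then have "\<not> determined n D' K" using assms by blast
  then obtain j where "j \<in> {..<n} - dom K"
    "cost n D' K = 1 + (\<Sum>c\<in>UNIV. cost n D' (K(j \<mapsto> c))) / real CARD('a)"
    by (rule cost_attained)
  then show "\<exists>j\<in>{..<n} - dom K.
      1 + (\<Sum>c\<in>UNIV. cost n D' (K(j \<mapsto> c))) / real CARD('a) \<le> cost n D' K"
    by (intro bexI[of _ j]) auto
qed (rule cost_nonneg)

text \<open>Words longer than the text never occur, so the output for \<open>D\<close> is the part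
  of the output for \<open>D'\<close> that belongs to words of \<open>D\<close>. This reduces
  infinite dictionaries to finite ones at each fixed \<open>n\<close>.\<close>

lemma determined_short:
  assumes "{w \<in> D. length w \<le> n} \<subseteq> D'" "determined n D' K"
  shows "determined n D K"
  unfolding determined_def
proof (intro ballI impI)
  fix \<xi> \<eta> :: "'a list"
  assume w: "\<xi> \<in> words n" "\<eta> \<in> words n" and a: "agrees K \<xi>" "agrees K \<eta>"
  have eq: "mpmp D' \<xi> = mpmp D' \<eta>" using assms(2) w a unfolding determined_def by blast
  have "(j, w) \<in> mpmp D \<zeta> \<longleftrightarrow> w \<in> D \<and> (j, w) \<in> mpmp D' \<zeta>" if "\<zeta> \<in> words n" for j w \<zeta>
    using that assms(1) by (auto simp: mpmp_def occurs_at_def words_def)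
  then show "mpmp D \<xi> = mpmp D \<eta>" using w eq by auto
qed

lemma cost_mono_short: "{w \<in> D. length w \<le> n} \<subseteq> D' \<Longrightarrow> cost n D K \<le> cost n D' K"
  by (rule cost_mono_determined) (rule determined_short)

section \<open>The dynamic program computes the optimum over all algorithms\<close>

definition completions :: "nat \<Rightarrow> (nat \<rightharpoonup> 'a::finite) \<Rightarrow> 'a list set" where
  "completions n K = {\<xi> \<in> words n. agrees K \<xi>}"

lemma finite_words [simp]: "finite (words n :: 'a::finite list set)"
  using finite_lists_length_eq[of "UNIV :: 'a set" n] by (simp add: words_def)

lemma card_words: "card (words n :: 'a::finite list set) = CARD('a) ^ n"
  using card_lists_length_eq[of "UNIV :: 'a set" n] by (simp add: words_def)

lemma words_nonempty [simp]: "words n \<noteq> {}"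
  using Ex_list_of_length[of n] by (auto simp: words_def)

lemma finite_completions [simp]: "finite (completions n K)"
  by (simp add: completions_def)

lemma completions_empty [simp]: "completions n Map.empty = words n"
  by (simp add: completions_def)

lemma sum_completions_split:
  fixes K :: "nat \<rightharpoonup> 'a::finite" and g :: "'a \<Rightarrow> 'a list \<Rightarrow> real"
  assumes "j \<in> {..<n} - dom K"
  shows "(\<Sum>\<xi>\<in>completions n K. g (\<xi> ! j) \<xi>) = (\<Sum>c\<in>UNIV. \<Sum>\<xi>\<in>completions n (K(j \<mapsto> c)). g c \<xi>)"
proof -
  have "completions n (K(j \<mapsto> c)) = {\<xi> \<in> completions n K. \<xi> ! j = c}" for c
    using assms by (auto simp: completions_def agrees_upd)
  then have "(\<Sum>c\<in>UNIV. \<Sum>\<xi>\<in>completions n (K(j \<mapsto> c)). g c \<xi>)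
    = (\<Sum>c\<in>UNIV. \<Sum>\<xi>\<in>{\<xi> \<in> completions n K. \<xi> ! j = c}. g (\<xi> ! j) \<xi>)" by simp
  also have "\<dots> = (\<Sum>\<xi>\<in>completions n K. g (\<xi> ! j) \<xi>)" by (rule sum.group) auto
  finally show ?thesis by simp
qed

lemma card_completions:
  fixes K :: "nat \<rightharpoonup> 'a::finite"
  assumes "dom K \<subseteq> {..<n}"
  shows "card (completions n K) = CARD('a) ^ card ({..<n} - dom K)"
  using assms
proof (induction K rule: unread_induct[where n = n])
  case (step K)
  show ?case
  proof (cases "{..<n} - dom K = {}")
    case True
    then have d: "dom K = {..<n}" using step.prems by blast
    have "completions n K = {map (the \<circ> K) [0..<n]}"
    proof (intro set_eqI iffI)
      fix \<xi> assume "\<xi> \<in> completions n K"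
      then have l: "length \<xi> = n" and a: "\<forall>i<n. K i = Some (\<xi> ! i)"
        by (auto simp: completions_def words_def agrees_def d)
      show "\<xi> \<in> {map (the \<circ> K) [0..<n]}" using l a by (auto intro!: nth_equalityI)
    next
      fix \<xi> assume "\<xi> \<in> {map (the \<circ> K) [0..<n]}"
      then have "\<xi> = map (the \<circ> K) [0..<n]" by simp
      moreover have "K i = Some (the (K i))" if "i < n" for i
        using d that by (metis domIff lessThan_iff option.collapse)
      ultimately show "\<xi> \<in> completions n K" by (auto simp: completions_def words_def agrees_def d)
    qed
    then show ?thesis unfolding True by simp
  next
    case False
    then obtain j where j: "j \<in> {..<n} - dom K" by blast
    have d: "dom (K(j \<mapsto> c)) \<subseteq> {..<n}" for c using j step.prems by auto
    have "card (completions n (K(j \<mapsto> c))) = CARD('a) ^ (card ({..<n} - dom K) - 1)" for c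
      unfolding step.IH[OF j d] card_unread_upd[OF j, of c] by simp
    moreover have "real (card (completions n K)) = (\<Sum>c\<in>UNIV. real (card (completions n (K(j \<mapsto> c)))))"
      using sum_completions_split[OF j, of "\<lambda>_ _. 1"] by simp
    ultimately have "real (card (completions n K)) = real CARD('a) * real CARD('a) ^ (card ({..<n} - dom K) - 1)"
      by simp
    also have "\<dots> = real (CARD('a) ^ card ({..<n} - dom K))"
      using False by (subst power_eq_if[of _ "card ({..<n} - dom K)"]) auto
    finally show ?thesis by (simp only: of_nat_eq_iff)
  qed
qed

lemma power_unread_upd:
  fixes K :: "nat \<rightharpoonup> 'a::finite"
  assumes "j \<in> {..<n} - dom K"
  shows "real CARD('a) ^ card ({..<n} - dom K)
    = real CARD('a) * real CARD('a) ^ card ({..<n} - dom (K(j \<mapsto> c)))"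
  unfolding card_unread_upd[OF assms, of c] by simp

text \<open>Randomisation cannot help: a random position averages values each of which is at least
  the minimum in \<open>cost\<close>. Sums over completions replace expectations, and the power of
  \<open>CARD('a)\<close> is the number of completions.\<close>

lemma solves_cost_le:
  fixes K :: "nat \<rightharpoonup> 'a::finite"
  assumes "solves_from n D A K" "dom K \<subseteq> {..<n}"
  shows "real CARD('a) ^ card ({..<n} - dom K) * cost n D K \<le> (\<Sum>\<xi>\<in>completions n K. expected_reads A \<xi>)"
  using assms
proof (induction A arbitrary: K)
  case Stop
  then show ?case by (simp add: cost_determined)
next
  case (Read p f)
  let ?s = "real CARD('a)"
  let ?u = "card ({..<n} - dom K)"
  from Read.prems have p: "set_pmf p \<subseteq> {..<n} - dom K"
    and sf: "\<And>j c. j \<in> set_pmf p \<Longrightarrow> solves_from n D (f j c) (K(j \<mapsto> c))" by auto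
  have s0: "?s > 0" by simp
  have fin: "finite (set_pmf p)" using p by (rule finite_subset) auto
  have er: "expected_reads (Read p f) \<xi> =
      1 + (\<Sum>j\<in>set_pmf p. pmf p j * expected_reads (f j (\<xi> ! j)) \<xi>)" for \<xi>
    by (simp add: integral_measure_pmf[OF fin])
  have each: "?s ^ ?u * (cost n D K - 1) \<le> (\<Sum>\<xi>\<in>completions n K. expected_reads (f j (\<xi> ! j)) \<xi>)"
    if j: "j \<in> set_pmf p" for j
  proof -
    have j': "j \<in> {..<n} - dom K" using p j by blast
    have d: "dom (K(j \<mapsto> c)) \<subseteq> {..<n}" for c using j' Read.prems(2) by auto
    have "?s ^ ?u * (cost n D K - 1)
        \<le> ?s ^ ?u * ((\<Sum>c\<in>UNIV. cost n D (K(j \<mapsto> c))) / ?s)"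
      using cost_le_read[OF j', of D] by (intro mult_left_mono) auto
    also have "\<dots> = (\<Sum>c\<in>UNIV. ?s ^ card ({..<n} - dom (K(j \<mapsto> c))) * cost n D (K(j \<mapsto> c)))"
    proof -
      have "?s ^ ?u / ?s = ?s ^ card ({..<n} - dom (K(j \<mapsto> c)))" for c
        unfolding power_unread_upd[OF j', of c] using s0 by simp
      then have "?s ^ card ({..<n} - dom (K(j \<mapsto> c))) = ?s ^ ?u / ?s" for c by metis
      then show ?thesis by (simp add: sum_distrib_left sum_divide_distrib del: dom_fun_upd)
    qed
    also have "\<dots> \<le> (\<Sum>c\<in>UNIV. \<Sum>\<xi>\<in>completions n (K(j \<mapsto> c)). expected_reads (f j c) \<xi>)"
      by (intro sum_mono Read.IH[OF rangeI rangeI sf[OF j] d])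
    also have "\<dots> = (\<Sum>\<xi>\<in>completions n K. expected_reads (f j (\<xi> ! j)) \<xi>)"
      using sum_completions_split[OF j', of "\<lambda>c. expected_reads (f j c)"] by simp
    finally show ?thesis .
  qed
  have one: "(\<Sum>j\<in>set_pmf p. pmf p j) = 1" by (rule sum_pmf_eq_1[OF fin]) simp
  have "?s ^ ?u * cost n D K = ?s ^ ?u + (\<Sum>j\<in>set_pmf p. pmf p j) * (?s ^ ?u * (cost n D K - 1))"
    unfolding one by (simp add: algebra_simps)
  also have "\<dots> \<le> ?s ^ ?u + (\<Sum>j\<in>set_pmf p. pmf p j * (\<Sum>\<xi>\<in>completions n K. expected_reads (f j (\<xi> ! j)) \<xi>))"
    unfolding sum_distrib_right using each by (intro add_left_mono sum_mono mult_left_mono) auto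
  also have "\<dots> = (\<Sum>\<xi>\<in>completions n K. expected_reads (Read p f) \<xi>)"
    unfolding er sum.distrib sum_distrib_left
    by (subst sum.swap) (simp add: card_completions[OF Read.prems(2)])
  finally show ?case .
qed

text \<open>The optimum is attained by a deterministic algorithm: point masses at minimising
  positions, the character read selecting the continuation.\<close>

lemma cost_solves:
  fixes K :: "nat \<rightharpoonup> 'a::finite"
  assumes "dom K \<subseteq> {..<n}"
  shows "\<exists>A. solves_from n D A K \<and>
    (\<Sum>\<xi>\<in>completions n K. expected_reads A \<xi>) = real CARD('a) ^ card ({..<n} - dom K) * cost n D K"
  using assms
proof (induction K rule: unread_induct[where n = n])
  case (step K)
  let ?s = "real CARD('a)"
  show ?case
  proof (cases "determined n D K")
    case True
    then show ?thesis by (intro exI[of _ Stop]) (simp add: cost_determined)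
  next
    case False
    then obtain j where j: "j \<in> {..<n} - dom K"
      and cj: "cost n D K = 1 + (\<Sum>c\<in>UNIV. cost n D (K(j \<mapsto> c))) / ?s"
      by (rule cost_attained)
    have d: "dom (K(j \<mapsto> c)) \<subseteq> {..<n}" for c using j step.prems by auto
    have "\<exists>A. solves_from n D A (K(j \<mapsto> c)) \<and> (\<Sum>\<xi>\<in>completions n (K(j \<mapsto> c)). expected_reads A \<xi>)
        = ?s ^ card ({..<n} - dom (K(j \<mapsto> c))) * cost n D (K(j \<mapsto> c))" for c
      by (rule step.IH[OF j d])
    then obtain F where F: "\<And>c. solves_from n D (F c) (K(j \<mapsto> c))"
      "\<And>c. (\<Sum>\<xi>\<in>completions n (K(j \<mapsto> c)). expected_reads (F c) \<xi>)
        = ?s ^ card ({..<n} - dom (K(j \<mapsto> c))) * cost n D (K(j \<mapsto> c))" by metis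
    let ?A = "Read (return_pmf j) (\<lambda>_ c. F c)"
    have "?s ^ card ({..<n} - dom K) / ?s = ?s ^ card ({..<n} - dom (K(j \<mapsto> c)))" for c
      unfolding power_unread_upd[OF j, of c] by simp
    then have pw: "?s ^ card ({..<n} - dom (K(j \<mapsto> c))) = ?s ^ card ({..<n} - dom K) / ?s" for c
      by metis
    have "(\<Sum>\<xi>\<in>completions n K. expected_reads ?A \<xi>)
        = real (card (completions n K)) + (\<Sum>\<xi>\<in>completions n K. expected_reads (F (\<xi> ! j)) \<xi>)"
      by (simp add: sum.distrib)
    also have "\<dots> = ?s ^ card ({..<n} - dom K) * cost n D K"
      unfolding cj sum_completions_split[OF j, of "\<lambda>c. expected_reads (F c)"] F(2) pw card_completions[OF step.prems]
      by (simp add: algebra_simps sum_distrib_left sum_divide_distrib del: dom_fun_upd)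
    finally show ?thesis using F(1) False j by (intro exI[of _ ?A]) auto
  qed
qed

lemma min_reads_eq_cost: "min_reads n D = cost n (D :: 'a::finite list set) Map.empty"
proof -
  let ?e = "\<lambda>A :: 'a algorithm. measure_pmf.expectation (pmf_of_set (words n)) (expected_reads A)"
  let ?S = "{A. solves n D A}"
  have e: "?e A = (\<Sum>\<xi>\<in>words n. expected_reads A \<xi>) / real CARD('a) ^ n" for A
    by (subst integral_pmf_of_set) (auto simp: card_words)
  have lower: "cost n D Map.empty \<le> ?e A" if "A \<in> ?S" for A
    using solves_cost_le[of n D A Map.empty] that unfolding e solves_def
    by (simp add: field_simps)
  obtain A where A: "A \<in> ?S" "?e A = cost n D Map.empty"
    using cost_solves[of Map.empty n D] unfolding e solves_def by auto
  show ?thesis unfolding min_reads_def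
  proof (rule antisym)
    show "(INF A\<in>?S. ?e A) \<le> cost n D Map.empty"
      using A(1) lower unfolding A(2)[symmetric]
      by (intro cINF_lower bdd_belowI2[of _ "cost n D Map.empty"]) (auto simp: A(2))
    show "cost n D Map.empty \<le> (INF A\<in>?S. ?e A)"
      using A(1) lower by (intro cINF_greatest) blast+
  qed
qed

text \<open>A solving run on \<open>\<xi>\<close> reads a certificate of \<open>\<xi>\<close>, so it is at least as long as the shortest one.\<close>

lemma certificate_le_cost:
  fixes k :: "'a::finite list \<Rightarrow> real"
  assumes cert: "\<And>\<xi> C. \<xi> \<in> words n \<Longrightarrow> C \<subseteq> {..<n} \<Longrightarrow>
      determined n D (\<lambda>x. if x \<in> C then Some (\<xi> ! x) else None) \<Longrightarrow> k \<xi> \<le> real (card C)"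
  shows "(\<Sum>\<xi>\<in>words n. k \<xi>) \<le> real CARD('a) ^ n * cost n D Map.empty"
proof -
  let ?s = "real CARD('a)"
  \<comment> \<open>Subtracting the reads already made closes the induction: at a determined
    \<open>K\<close> the set \<open>dom K\<close> is itself a certificate, so every summand is at
    most 0.\<close>
  have "dom K \<subseteq> {..<n} \<Longrightarrow> (\<Sum>\<xi>\<in>completions n K. k \<xi> - real (card (dom K)))
      \<le> ?s ^ card ({..<n} - dom K) * cost n D K" for K
  proof (induction K rule: unread_induct[where n = n])
    case (step K)
    show ?case
    proof (cases "determined n D K")
      case True
      have "k \<xi> - real (card (dom K)) \<le> 0" if \<xi>: "\<xi> \<in> completions n K" for \<xi>
      proof -
        have "(\<lambda>x. if x \<in> dom K then Some (\<xi> ! x) else None) = K"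
          using \<xi> by (auto simp: completions_def agrees_def domIff)
        then show ?thesis using cert[of \<xi> "dom K"] True step.prems \<xi> by (auto simp: completions_def)
      qed
      then show ?thesis by (simp add: True cost_determined sum_nonpos)
    next
      case False
      then obtain j where j: "j \<in> {..<n} - dom K"
        and cj: "cost n D K = 1 + (\<Sum>c\<in>UNIV. cost n D (K(j \<mapsto> c))) / ?s"
        by (rule cost_attained)
      have d: "dom (K(j \<mapsto> c)) \<subseteq> {..<n}" for c using j step.prems by auto
      have fin: "finite (dom K)" using step.prems finite_subset by blast
      have "?s ^ card ({..<n} - dom K) / ?s = ?s ^ card ({..<n} - dom (K(j \<mapsto> c)))" for c
        unfolding power_unread_upd[OF j, of c] by simp
      then have pw: "?s ^ card ({..<n} - dom (K(j \<mapsto> c))) = ?s ^ card ({..<n} - dom K) / ?s" for c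
        by metis
      have cd: "real (card (dom (K(j \<mapsto> c)))) = real (card (dom K)) + 1" for c
        using j fin by (simp add: card_insert_if)
      have "(\<Sum>\<xi>\<in>completions n K. k \<xi> - real (card (dom K)))
          = ?s ^ card ({..<n} - dom K) + (\<Sum>\<xi>\<in>completions n K. k \<xi> - (real (card (dom K)) + 1))"
        by (simp add: sum_subtractf sum.distrib card_completions[OF step.prems] algebra_simps)
      also have "(\<Sum>\<xi>\<in>completions n K. k \<xi> - (real (card (dom K)) + 1))
          = (\<Sum>c\<in>UNIV. \<Sum>\<xi>\<in>completions n (K(j \<mapsto> c)). k \<xi> - real (card (dom (K(j \<mapsto> c)))))"
        unfolding cd by (rule sum_completions_split[OF j])
      also have "\<dots> \<le> (\<Sum>c\<in>UNIV. ?s ^ card ({..<n} - dom (K(j \<mapsto> c))) * cost n D (K(j \<mapsto> c)))"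
        by (intro sum_mono step.IH[OF j d])
      finally show ?thesis
        unfolding cj pw by (simp add: algebra_simps sum_distrib_left sum_divide_distrib del: dom_fun_upd)
    qed
  qed
  from this[of Map.empty] show ?thesis by simp
qed

section \<open>Superadditivity and the complexity rate\<close>

lemma occurs_at_iff:
  "occurs_at w \<xi> j \<longleftrightarrow> j + length w \<le> length \<xi> \<and> (\<forall>i<length w. \<xi> ! (j + i) = w ! i)"
  by (auto simp: occurs_at_def list_eq_iff_nth_eq)

lemma completion_exists:
  assumes d: "dom K' \<subseteq> {..<k}"
  obtains \<zeta> where "\<zeta> \<in> words k" "agrees K' \<zeta>"
proof
  show "map (\<lambda>x. the (K' x)) [0..<k] \<in> words k" by (simp add: words_def)
  show "agrees K' (map (\<lambda>x. the (K' x)) [0..<k])"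
    unfolding agrees_iff
  proof (intro allI impI)
    fix j c assume j: "K' j = Some c"
    then have "j < k" using d by blast
    then show "map (\<lambda>x. the (K' x)) [0..<k] ! j = c" using j by simp
  qed
qed

text \<open>One completion \<zeta> of the right part is frozen. The output on \<theta> consists of
  the occurrences in \<open>\<theta> @ \<zeta>\<close> that end by position \<open>n\<close>, so it
  inherits determinacy.\<close>

lemma determined_left:
  fixes K :: "nat \<rightharpoonup> 'a::finite"
  assumes det: "determined (n + k) D K" and d: "dom K \<subseteq> {..<n + k}"
  shows "determined n D (K |` {..<n})"
  unfolding determined_def
proof (intro ballI impI)
  fix \<xi> \<eta> :: "'a list"
  assume w: "\<xi> \<in> words n" "\<eta> \<in> words n" and a: "agrees (K |` {..<n}) \<xi>" "agrees (K |` {..<n}) \<eta>"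
  have "dom (\<lambda>x. K (n + x)) \<subseteq> {..<k}" using d by auto
  then obtain \<zeta> where \<zeta>: "\<zeta> \<in> words k" "agrees (\<lambda>x. K (n + x)) \<zeta>"
    using completion_exists by blast
  have agr: "agrees K (\<theta> @ \<zeta>)" if "\<theta> \<in> words n" "agrees (K |` {..<n}) \<theta>" for \<theta>
    unfolding agrees_iff
  proof (intro allI impI)
    fix j c assume K: "K j = Some c"
    show "(\<theta> @ \<zeta>) ! j = c"
    proof (cases "j < n")
      case True
      then have "(K |` {..<n}) j = Some c" using K by simp
      then show ?thesis using that True unfolding agrees_iff by (auto simp: nth_append words_def)
    next
      case False
      then have "K (n + (j - n)) = Some c" using K by simp
      then show ?thesis using \<zeta> that False unfolding agrees_iff by (auto simp: nth_append words_def)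
    qed
  qed
  have "mpmp D (\<xi> @ \<zeta>) = mpmp D (\<eta> @ \<zeta>)"
    using det agr w a \<zeta>(1) unfolding determined_def by (auto simp: words_def)
  moreover have "mpmp D \<theta> = {(j, w) \<in> mpmp D (\<theta> @ \<zeta>). j + length w \<le> n}" if "\<theta> \<in> words n" for \<theta>
    using that nth_append_left[of _ \<theta> \<zeta>] unfolding mpmp_def occurs_at_iff words_def
    by auto
  ultimately show "mpmp D \<xi> = mpmp D \<eta>" by (simp only: w)
qed

lemma determined_right:
  fixes K :: "nat \<rightharpoonup> 'a::finite"
  assumes det: "determined (n + k) D K" and d: "dom K \<subseteq> {..<n + k}"
  shows "determined k D (\<lambda>x. K (n + x))"
  unfolding determined_def
proof (intro ballI impI)
  fix \<xi> \<eta> :: "'a list"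
  assume w: "\<xi> \<in> words k" "\<eta> \<in> words k"
    and a: "agrees (\<lambda>x. K (n + x)) \<xi>" "agrees (\<lambda>x. K (n + x)) \<eta>"
  have "dom (K |` {..<n}) \<subseteq> {..<n}" by auto
  then obtain \<zeta> where \<zeta>: "\<zeta> \<in> words n" "agrees (K |` {..<n}) \<zeta>"
    using completion_exists by blast
  have agr: "agrees K (\<zeta> @ \<theta>)" if "\<theta> \<in> words k" "agrees (\<lambda>x. K (n + x)) \<theta>" for \<theta>
    unfolding agrees_iff
  proof (intro allI impI)
    fix j c assume K: "K j = Some c"
    show "(\<zeta> @ \<theta>) ! j = c"
    proof (cases "j < n")
      case True
      then have "(K |` {..<n}) j = Some c" using K by simp
      then show ?thesis using \<zeta> True unfolding agrees_iff by (auto simp: nth_append words_def)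
    next
      case False
      then have "K (n + (j - n)) = Some c" using K by simp
      then show ?thesis using \<zeta> that False unfolding agrees_iff by (auto simp: nth_append words_def)
    qed
  qed
  have "mpmp D (\<zeta> @ \<xi>) = mpmp D (\<zeta> @ \<eta>)"
    using det agr w a \<zeta>(1) unfolding determined_def by (auto simp: words_def)
  moreover have "mpmp D \<theta> = {(j, w). (n + j, w) \<in> mpmp D (\<zeta> @ \<theta>)}" if "\<theta> \<in> words k" for \<theta>
    using that \<zeta>(1) nth_append_length_plus[of \<zeta> \<theta>]
    unfolding mpmp_def occurs_at_iff words_def by (simp add: add.assoc)
  ultimately show "mpmp D \<xi> = mpmp D \<eta>" by (simp only: w)
qed

text \<open>Each read of the long text advances exactly one of the two parts and leaves the other
  unchanged. Occurrences across the boundary can only add work, hence an inequality.\<close>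

lemma cost_split:
  fixes K :: "nat \<rightharpoonup> 'a::finite"
  assumes "dom K \<subseteq> {..<n + k}"
  shows "cost n D (K |` {..<n}) + cost k D (\<lambda>x. K (n + x)) \<le> cost (n + k) D K"
  using assms
proof (induction K rule: unread_induct[where n = "n + k"])
  case (step K)
  let ?s = "real CARD('a)"
  let ?L = "\<lambda>K. cost n D (K |` {..<n})"
  let ?R = "\<lambda>K :: nat \<rightharpoonup> 'a. cost k D (\<lambda>x. K (n + x))"
  show ?case
  proof (cases "determined (n + k) D K")
    case True
    then show ?thesis
      using determined_left[OF True step.prems] determined_right[OF True step.prems]
      by (simp add: cost_determined)
  next
    case False
    then obtain j where j: "j \<in> {..<n + k} - dom K"
      and cj: "cost (n + k) D K = 1 + (\<Sum>c\<in>UNIV. cost (n + k) D (K(j \<mapsto> c))) / ?s"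
      by (rule cost_attained)
    have d: "dom (K(j \<mapsto> c)) \<subseteq> {..<n + k}" for c using j step.prems by auto
    have IH: "?L (K(j \<mapsto> c)) + ?R (K(j \<mapsto> c)) \<le> cost (n + k) D (K(j \<mapsto> c))" for c
      by (rule step.IH[OF j d])
    have "?L K + ?R K \<le> 1 + (\<Sum>c\<in>UNIV. ?L (K(j \<mapsto> c)) + ?R (K(j \<mapsto> c))) / ?s"
    proof (cases "j < n")
      case True
      have R: "?R (K(j \<mapsto> c)) = ?R K" for c using True by (intro arg_cong[of _ _ "cost k D"]) auto
      have K': "(K(j \<mapsto> c)) |` {..<n} = (K |` {..<n})(j \<mapsto> c)" for c
        using True by (auto simp: restrict_map_def)
      have "j \<in> {..<n} - dom (K |` {..<n})" using True j by auto
      then have "?L K \<le> 1 + (\<Sum>c\<in>UNIV. ?L (K(j \<mapsto> c))) / ?s"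
        unfolding K' by (rule cost_le_read)
      then show ?thesis unfolding R by (simp add: sum.distrib add_divide_distrib)
    next
      case False
      have L: "?L (K(j \<mapsto> c)) = ?L K" for c
        using False by (intro arg_cong[of _ _ "cost n D"]) (auto simp: restrict_map_def)
      have K': "(\<lambda>x. (K(j \<mapsto> c)) (n + x)) = (\<lambda>x. K (n + x))(j - n \<mapsto> c)" for c
        using False by (auto simp: fun_eq_iff)
      have "j - n \<in> {..<k} - dom (\<lambda>x. K (n + x))" using False j by auto
      then have "?R K \<le> 1 + (\<Sum>c\<in>UNIV. ?R (K(j \<mapsto> c))) / ?s"
        unfolding K' by (rule cost_le_read)
      then show ?thesis unfolding L by (simp add: sum.distrib add_divide_distrib)
    qed
    also have "\<dots> \<le> cost (n + k) D K"
      unfolding cj by (intro add_left_mono divide_right_mono sum_mono IH) simp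
    finally show ?thesis .
  qed
qed

lemma cost_superadditive:
  "cost n D Map.empty + cost k D Map.empty \<le> cost (n + k) (D :: 'a::finite list set) Map.empty"
  using cost_split[of Map.empty n k D] by simp

text \<open>Fekete's lemma; \<open>bound\<close> makes the supremum \<open>L\<close> finite.\<close>

lemma superadditive_limit:
  fixes a :: "nat \<Rightarrow> real"
  assumes super: "\<And>m n. a m + a n \<le> a (m + n)" and nonneg: "\<And>n. 0 \<le> a n"
    and bound: "\<And>n. a n \<le> C * real n"
  shows "\<exists>L. (\<lambda>n. a n / real n) \<longlonglongrightarrow> L \<and> (\<forall>k>0. a k / real k \<le> L)"
proof -
  define L where "L = (SUP k\<in>{0<..}. a k / real k)"
  have bdd: "bdd_above ((\<lambda>k. a k / real k) ` {0<..})"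
    using bound by (intro bdd_aboveI2[of _ _ C]) (auto simp: field_simps)
  have upper: "a k / real k \<le> L" if "k > 0" for k
    unfolding L_def using that bdd by (intro cSUP_upper) auto
  have mult: "real q * a k \<le> a (q * k)" for q k
  proof (induction q)
    case (Suc q)
    then show ?case using super[of k "q * k"] by (simp add: algebra_simps)
  qed (use nonneg in simp)
  have "(\<lambda>n. a n / real n) \<longlonglongrightarrow> L"
  proof (rule order_tendstoI)
    fix y assume "y < L"
    then obtain k where k: "k > 0" "y < a k / real k"
      unfolding L_def using bdd by (subst (asm) less_cSUP_iff) auto
    \<comment> \<open>The text length is split into \<open>n div k\<close> blocks of length
      \<open>k\<close> and a remainder, which loses less than one block.\<close>
    have lower: "a k / real k - a k / real n \<le> a n / real n" if "n > 0" for n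
    proof -
      have "real n \<le> real k * (real (n div k) + 1)"
      proof -
        have "n < k * (n div k + 1)" using k(1)
          by (metis Suc_eq_plus1 dividend_less_times_div mult_Suc_right add.commute)
        then have "real n \<le> real (k * (n div k + 1))" by linarith
        then show ?thesis by (simp add: algebra_simps)
      qed
      then have "real n / real k - 1 \<le> real (n div k)" using k(1) by (simp add: field_simps)
      then have "(real n / real k - 1) * a k \<le> real (n div k) * a k"
        using nonneg by (rule mult_right_mono)
      also have "\<dots> \<le> a (n div k * k)" by (rule mult)
      also have "\<dots> \<le> a (n div k * k) + a (n mod k)" using nonneg[of "n mod k"] by simp
      also have "\<dots> \<le> a n" using super[of "n div k * k" "n mod k"] by simp
      finally have "((real n / real k - 1) * a k) / real n \<le> a n / real n"
        by (rule divide_right_mono) simp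
      then show ?thesis using that by (simp add: field_simps)
    qed
    have "(\<lambda>n. a k / real k - a k / real n) \<longlonglongrightarrow> a k / real k - 0"
      by (intro tendsto_intros lim_const_over_n)
    then have "\<forall>\<^sub>F n in sequentially. y < a k / real k - a k / real n"
      using k(2) by (intro order_tendstoD) auto
    then show "\<forall>\<^sub>F n in sequentially. y < a n / real n"
      using eventually_gt_at_top[of 0]
    proof eventually_elim
      case (elim n)
      then show ?case using lower[of n] by linarith
    qed
  next
    fix y assume "L < y"
    show "\<forall>\<^sub>F n in sequentially. a n / real n < y"
      using eventually_gt_at_top[of 0]
    proof eventually_elim
      case (elim n)
      then show ?case using upper[of n] \<open>L < y\<close> by linarith
    qed
  qed
  then show ?thesis using upper by blast
qed

lemma rate_converges:
  fixes D :: "'a::finite list set"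
  obtains L where "(\<lambda>n. min_reads n D / real n) \<longlonglongrightarrow> L"
    "\<And>k. k > 0 \<Longrightarrow> cost k D Map.empty / real k \<le> L" "Phi D = ln (real CARD('a)) * L"
proof -
  obtain L where L: "(\<lambda>n. cost n D Map.empty / real n) \<longlonglongrightarrow> L"
    "\<forall>k>0. cost k D Map.empty / real k \<le> L"
    using superadditive_limit[of "\<lambda>n. cost n D Map.empty" 1]
      cost_superadditive[of _ D] cost_nonneg[of _ D] cost_le_length[of _ D] by auto
  then show ?thesis
    using that unfolding Phi_def min_reads_eq_cost by (auto simp: limI)
qed

lemma ln_card_nonneg [simp]: "0 \<le> ln (real CARD('a::finite))"
proof -
  have "CARD('a) > 0" by simp
  then show ?thesis by (intro ln_ge_zero) linarith
qed

lemma Phi_ge_cost: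
  fixes D :: "'a::finite list set"
  assumes "k > 0"
  shows "ln (real CARD('a)) * (cost k D Map.empty / real k) \<le> Phi D"
proof -
  obtain L where "(\<lambda>n. min_reads n D / real n) \<longlonglongrightarrow> L"
    "\<And>k. k > 0 \<Longrightarrow> cost k D Map.empty / real k \<le> L" "Phi D = ln (real CARD('a)) * L"
    by (rule rate_converges[of D]) blast
  then show ?thesis using assms by (simp only: mult_left_mono[OF _ ln_card_nonneg])
qed

lemma Phi_le:
  fixes D :: "'a::finite list set"
  assumes "\<And>n. n > 0 \<Longrightarrow> ln (real CARD('a)) * (cost n D Map.empty / real n) \<le> B"
  shows "Phi D \<le> B"
proof -
  obtain L where L: "(\<lambda>n. min_reads n D / real n) \<longlonglongrightarrow> L" "Phi D = ln (real CARD('a)) * L"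
    by (rule rate_converges[of D]) blast
  have "(\<lambda>n. ln (real CARD('a)) * (min_reads n D / real n)) \<longlonglongrightarrow> Phi D"
    unfolding L(2) by (intro tendsto_intros L(1))
  moreover have "\<forall>\<^sub>F n in sequentially. ln (real CARD('a)) * (min_reads n D / real n) \<le> B"
    using eventually_gt_at_top[of 0]
    by eventually_elim (simp only: assms min_reads_eq_cost)
  ultimately show ?thesis by (rule tendsto_upperbound) simp
qed

lemma Phi_nonneg: "0 \<le> Phi (D :: 'a::finite list set)"
proof -
  have "0 \<le> ln (real CARD('a)) * (cost 1 D Map.empty / real 1)"
    by (intro mult_nonneg_nonneg divide_nonneg_nonneg cost_nonneg) auto
  also have "\<dots> \<le> Phi D" by (rule Phi_ge_cost) simp
  finally show ?thesis .
qed

lemma Phi_le_ln: "Phi (D :: 'a::finite list set) \<le> ln (real CARD('a))"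
proof (rule Phi_le)
  fix n :: nat assume "n > 0"
  then have "cost n D Map.empty / real n \<le> 1" using cost_le_length[of n D] by simp
  then show "ln (real CARD('a)) * (cost n D Map.empty / real n) \<le> ln (real CARD('a))"
    by (rule mult_left_le) simp
qed

lemma Phi_mono:
  fixes D D' :: "'a::finite list set"
  assumes "D \<subseteq> D'"
  shows "Phi D \<le> Phi D'"
proof (rule Phi_le)
  fix n :: nat assume n: "n > 0"
  have "cost n D Map.empty \<le> cost n D' Map.empty" using assms by (intro cost_mono_short) auto
  then have "ln (real CARD('a)) * (cost n D Map.empty / real n)
      \<le> ln (real CARD('a)) * (cost n D' Map.empty / real n)"
    by (intro mult_left_mono divide_right_mono) auto
  also have "\<dots> \<le> Phi D'" using n by (rule Phi_ge_cost)
  finally show "ln (real CARD('a)) * (cost n D Map.empty / real n) \<le> Phi D'" .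
qed

section \<open>Random dictionaries\<close>

interpretation word_measures: product_prob_space
  "\<lambda>(m, i). uniform_count_measure (words m :: 'a::finite list set)" "I :: (nat \<times> nat) set" for I
  by (rule product_prob_spaceI)
    (auto intro: prob_space_uniform_count_measure)

lemma prob_space_random_words: "prob_space (random_words r :: (nat \<times> nat \<Rightarrow> 'a::finite list) measure)"
  unfolding random_words_def by (rule word_measures.P.prob_space_axioms)

lemma space_random_words:
  "space (random_words r :: (nat \<times> nat \<Rightarrow> 'a::finite list) measure)
    = (\<Pi>\<^sub>E (m, i) \<in> slots r. words m)"
  unfolding random_words_def space_PiM
  by (intro PiE_cong) (auto simp: space_uniform_count_measure)

lemma length_random_word:
  assumes "\<omega> \<in> space (random_words r :: (nat \<times> nat \<Rightarrow> 'a::finite list) measure)" "i < r m"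
  shows "length (\<omega> (m, i)) = m"
  using assms PiE_mem[of \<omega> "slots r" _ "(m, i)"]
  unfolding space_random_words by (auto simp: slots_def words_def)

text \<open>For fixed \<open>n\<close> only the finitely many slots of length at most
  \<open>n\<close> matter, and their product space is discrete; \<open>Phi\<close> is then a
  pointwise limit of measurable functions.\<close>

lemma Phi_measurable:
  "(\<lambda>\<omega>. Phi (\<omega> ` slots r)) \<in> borel_measurable (random_words r :: (nat \<times> nat \<Rightarrow> 'a::finite list) measure)"
proof -
  let ?M = "random_words r :: (nat \<times> nat \<Rightarrow> 'a list) measure"
  have "(\<lambda>\<omega>. min_reads n (\<omega> ` slots r)) \<in> borel_measurable ?M" for n
  proof -
    define F where "F = (SIGMA m:{..n}. {..<r m})"
    let ?U = "\<lambda>(m, i :: nat). uniform_count_measure (words m :: 'a list set)"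
    let ?C = "\<lambda>(m, i :: nat). count_space (words m :: 'a list set)"
    have F: "finite F" "F \<subseteq> slots r" by (auto simp: F_def slots_def)
    have "Pi\<^sub>M F ?C = Pi\<^sub>M F (\<lambda>x. count_space (words (fst x)))"
      by (intro PiM_cong) auto
    also have "\<dots> = count_space (\<Pi>\<^sub>E x\<in>F. words (fst x))"
      using F(1) by (intro count_space_PiM_finite) (auto intro: countable_finite)
    finally have C: "Pi\<^sub>M F ?C = count_space (\<Pi>\<^sub>E x\<in>F. words (fst x))" .
    have sets: "sets (Pi\<^sub>M F ?U) = sets (Pi\<^sub>M F ?C)"
      by (intro sets_PiM_cong) (auto simp: sets_uniform_count_measure_count_space)
    have "(\<lambda>\<omega>. restrict \<omega> F) \<in> measurable ?M (Pi\<^sub>M F ?U)"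
      unfolding random_words_def by (rule measurable_restrict_subset[OF F(2)])
    moreover have "(\<lambda>\<omega>. min_reads n (\<omega> ` F)) \<in> borel_measurable (Pi\<^sub>M F ?U)"
      unfolding measurable_cong_sets[OF sets refl] C by simp
    ultimately have "(\<lambda>\<omega>. min_reads n (restrict \<omega> F ` F)) \<in> borel_measurable ?M"
      by (rule measurable_compose)
    moreover have "min_reads n (\<omega> ` slots r) = min_reads n (restrict \<omega> F ` F)"
      if \<omega>: "\<omega> \<in> space ?M" for \<omega>
      unfolding min_reads_eq_cost
    proof (rule antisym)
      have "{w \<in> \<omega> ` slots r. length w \<le> n} \<subseteq> \<omega> ` F"
        using length_random_word[OF \<omega>] by (auto simp: slots_def F_def)
      then show "cost n (\<omega> ` slots r) Map.empty \<le> cost n (restrict \<omega> F ` F) Map.empty"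
        by (intro cost_mono_short) simp
      show "cost n (restrict \<omega> F ` F) Map.empty \<le> cost n (\<omega> ` slots r) Map.empty"
        using F(2) by (intro cost_mono_short) auto
    qed
    ultimately show ?thesis by (subst measurable_cong) auto
  qed
  then show ?thesis unfolding Phi_def by measurable
qed

lemma Phi_integrable:
  "integrable (random_words r :: (nat \<times> nat \<Rightarrow> 'a::finite list) measure) (\<lambda>\<omega>. Phi (\<omega> ` slots r))"
proof -
  interpret prob_space "random_words r :: (nat \<times> nat \<Rightarrow> 'a list) measure"
    by (rule prob_space_random_words)
  show ?thesis
    by (rule integrable_const_bound[of _ "ln (real CARD('a))"])
      (auto simp: Phi_measurable Phi_nonneg Phi_le_ln)
qed

text \<open>Random words may repeat, so the content of a sampled dictionary can fall below
  \<open>r\<close>. Padding it to content exactly \<open>r\<close> makes it a competitor in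
  \<open>Phi_max\<close>, and \<open>Phi_mono\<close> controls the effect.\<close>

lemma dictionary_extension:
  fixes D :: "'a::finite list set"
  assumes "\<And>m. content D m \<le> r m" "\<And>m. r m \<le> CARD('a) ^ m" "r 0 = 0"
  obtains D' where "D \<subseteq> D'" "dictionary D'" "content D' = r"
proof -
  have "\<exists>E. {w \<in> D. length w = m} \<subseteq> E \<and> E \<subseteq> words m \<and> card E = r m" for m
  proof -
    have "{w \<in> D. length w = m} \<subseteq> words m" by (auto simp: words_def)
    then show ?thesis
      using assms(1,2)[of m] exists_subset_between[of "{w \<in> D. length w = m}" "r m" "words m"]
      by (auto simp: content_def card_words)
  qed
  then obtain E where E: "\<And>m. {w \<in> D. length w = m} \<subseteq> E m" "\<And>m. E m \<subseteq> words m"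
    "\<And>m. card (E m) = r m" by metis
  have eq: "{w \<in> \<Union>(range E). length w = m} = E m" for m
    using E(2) by (auto simp: words_def)
  show ?thesis
  proof
    show "D \<subseteq> \<Union>(range E)" using E(1) by blast
    show "content (\<Union>(range E)) = r" unfolding fun_eq_iff content_def eq using E(3) by blast
    have "E 0 = {}" using E(3)[of 0] assms(3) finite_subset[OF E(2) finite_words] by simp
    then have "[] \<notin> \<Union>(range E)" using eq[of 0] by auto
    then show "dictionary (\<Union>(range E))" by (simp add: dictionary_def)
  qed
qed

lemma Phi_aver_le_Phi_max:
  assumes "\<And>m. r m \<le> CARD('a::finite) ^ m" "r 0 = 0"
  shows "Phi_aver TYPE('a) r \<le> Phi_max TYPE('a) r"
proof -
  let ?M = "random_words r :: (nat \<times> nat \<Rightarrow> 'a list) measure"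
  interpret prob_space ?M by (rule prob_space_random_words)
  have "Phi (\<omega> ` slots r) \<le> Phi_max TYPE('a) r" if \<omega>: "\<omega> \<in> space ?M" for \<omega>
  proof -
    have "content (\<omega> ` slots r) m \<le> r m" for m
    proof -
      have "{w \<in> \<omega> ` slots r. length w = m} \<subseteq> (\<lambda>i. \<omega> (m, i)) ` {..<r m}"
        using length_random_word[OF \<omega>] by (auto simp: slots_def)
      then have "content (\<omega> ` slots r) m \<le> card ((\<lambda>i. \<omega> (m, i)) ` {..<r m})"
        unfolding content_def by (intro card_mono) auto
      also have "\<dots> \<le> r m" using card_image_le[of "{..<r m}"] by simp
      finally show ?thesis .
    qed
    then obtain D' where D': "\<omega> ` slots r \<subseteq> D'" "dictionary D'" "content D' = r"
      using dictionary_extension assms by blast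
    have "Phi (\<omega> ` slots r) \<le> Phi D'" by (rule Phi_mono[OF D'(1)])
    also have "\<dots> \<le> Phi_max TYPE('a) r"
      unfolding Phi_max_def using D'(2,3)
      by (intro cSUP_upper bdd_aboveI2[of _ _ "ln (real CARD('a))"]) (auto simp: Phi_le_ln)
    finally show ?thesis .
  qed
  then have "(\<integral>\<omega>. Phi (\<omega> ` slots r) \<partial>?M) \<le> (\<integral>\<omega>. Phi_max TYPE('a) r \<partial>?M)"
    by (intro integral_mono Phi_integrable) auto
  then show ?thesis unfolding Phi_aver_def by (simp add: prob_space)
qed

section \<open>Upper bound: sampling, then checking the surviving occurrences\<close>

definition placements :: "nat \<Rightarrow> 'a::finite list set \<Rightarrow> (nat \<times> 'a list) set" where
  "placements n D = {(j, w). w \<in> D \<and> j + length w \<le> n}"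

definition consistent :: "(nat \<rightharpoonup> 'a) \<Rightarrow> nat \<Rightarrow> 'a list \<Rightarrow> bool" where
  "consistent K j w \<longleftrightarrow> (\<forall>i<length w. \<forall>c. K (j + i) = Some c \<longrightarrow> c = w ! i)"

text \<open>
  The expected number of reads spent on checking the placement \<open>w\<close> at \<open>j\<close>, once the remaining
  positions of \<open>T\<close> have been read: it survives these with probability \<open>s\<^sup>-\<^sup>k\<close>, and checking
  character by character until the first mismatch costs at most \<open>1 + 1/s + 1/s\<^sup>2 + \<dots>\<close> reads.
\<close>

definition weight :: "nat set \<Rightarrow> (nat \<rightharpoonup> 'a::finite) \<Rightarrow> nat \<Rightarrow> 'a list \<Rightarrow> real" where
  "weight T K j w =
     (if consistent K j w \<and> \<not> {j..<j + length w} \<subseteq> dom K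
      then (1 / real CARD('a)) ^ card (T \<inter> {j..<j + length w} - dom K)
        * (real CARD('a) / (real CARD('a) - 1))
      else 0)"

lemma finite_placements [simp]: "finite (placements n (D :: 'a::finite list set))"
proof (rule finite_subset)
  show "placements n D \<subseteq> {..n} \<times> {w. set w \<subseteq> UNIV \<and> length w \<le> n}"
    by (auto simp: placements_def)
  show "finite ({..n} \<times> {w :: 'a list. set w \<subseteq> UNIV \<and> length w \<le> n})"
    by (intro finite_cartesian_product finite_lists_length_le) auto
qed

text \<open>An inconsistent placement occurs in no completion, a consistent one that has been read
  completely occurs in all of them.\<close>

lemma determined_if_checked:
  fixes K :: "nat \<rightharpoonup> 'a::finite"
  assumes "\<And>j w. (j, w) \<in> placements n D \<Longrightarrow> consistent K j w \<Longrightarrow> {j..<j + length w} \<subseteq> dom K"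
  shows "determined n D K"
proof -
  have sub: "mpmp D \<xi> \<subseteq> mpmp D \<eta>"
    if w: "\<xi> \<in> words n" "\<eta> \<in> words n" and a: "agrees K \<xi>" "agrees K \<eta>" for \<xi> \<eta> :: "'a list"
  proof clarify
    fix j w assume "(j, w) \<in> mpmp D \<xi>"
    then have wD: "w \<in> D" and l: "j + length w \<le> n" and m: "\<forall>i<length w. \<xi> ! (j + i) = w ! i"
      using w by (auto simp: mpmp_def occurs_at_iff words_def)
    have "consistent K j w" using m a(1) unfolding consistent_def agrees_iff by metis
    then have d: "{j..<j + length w} \<subseteq> dom K" using assms wD l by (simp add: placements_def)
    have "\<eta> ! (j + i) = w ! i" if i: "i < length w" for i
    proof -
      have "j + i \<in> dom K" by (rule subsetD[OF d]) (use i in simp)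
      then obtain c where "K (j + i) = Some c" by blast
      then have "\<xi> ! (j + i) = c" "\<eta> ! (j + i) = c" using a unfolding agrees_iff by blast+
      then show ?thesis using m i by simp
    qed
    then show "(j, w) \<in> mpmp D \<eta>" using wD l w by (auto simp: mpmp_def occurs_at_iff words_def)
  qed
  show ?thesis unfolding determined_def by (intro ballI impI equalityI sub)
qed

lemma weight_nonneg: "CARD('a::finite) \<ge> 2 \<Longrightarrow> 0 \<le> weight T (K :: nat \<rightharpoonup> 'a) j w"
  by (simp add: weight_def)

lemma consistent_upd:
  fixes K :: "nat \<rightharpoonup> 'a"
  assumes "x \<notin> dom K" "x \<in> {j..<j + length w}"
  shows "consistent (K(x \<mapsto> c)) j w \<longleftrightarrow> consistent K j w \<and> c = w ! (x - j)"
proof -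
  have x: "x = j + (x - j)" "x - j < length w" using assms(2) by auto
  have n: "K x = None" using assms(1) by blast
  show ?thesis
  proof
    assume a: "consistent (K(x \<mapsto> c)) j w"
    have "c = w ! (x - j)" using a x unfolding consistent_def by (metis fun_upd_same)
    moreover have "consistent K j w"
      unfolding consistent_def
    proof (intro allI impI)
      fix i d assume i: "i < length w" "K (j + i) = Some d"
      then have "j + i \<noteq> x" using n by auto
      then show "d = w ! i" using a i unfolding consistent_def by simp
    qed
    ultimately show "consistent K j w \<and> c = w ! (x - j)" by blast
  next
    assume "consistent K j w \<and> c = w ! (x - j)"
    then show "consistent (K(x \<mapsto> c)) j w" unfolding consistent_def by auto
  qed
qed

text \<open>Only the character \<open>w ! (x - j)\<close> keeps the placement alive. There is no
  equality in general, since the read may complete the placement and so drop its weight to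
  0.\<close>

lemma weight_read_inside:
  fixes K :: "nat \<rightharpoonup> 'a::finite"
  assumes s: "CARD('a) \<ge> 2" and x: "x \<in> {j..<j + length w} - dom K" and con: "consistent K j w"
  shows "(\<Sum>c\<in>UNIV. weight T (K(x \<mapsto> c)) j w)
    \<le> (1 / real CARD('a)) ^ card (T \<inter> {j..<j + length w} - dom K - {x})
      * (real CARD('a) / (real CARD('a) - 1))" (is "_ \<le> ?B")
proof -
  have 0: "0 \<le> ?B" using s by simp
  have d: "T \<inter> {j..<j + length w} - dom (K(x \<mapsto> c)) = T \<inter> {j..<j + length w} - dom K - {x}" for c
    by (simp only: dom_fun_upd) (simp, blast)
  have "weight T (K(x \<mapsto> c)) j w \<le> (if c = w ! (x - j) then ?B else 0)" for c
    using x con 0 consistent_upd[of x K j w c] unfolding weight_def d by auto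
  then have "(\<Sum>c\<in>UNIV. weight T (K(x \<mapsto> c)) j w)
      \<le> (\<Sum>c\<in>(UNIV :: 'a set). if c = w ! (x - j) then ?B else 0)" by (intro sum_mono)
  also have "\<dots> = ?B" by (simp add: sum.delta)
  finally show ?thesis .
qed

text \<open>Supermartingale property: survival has probability 1/s, and the exponent of 1/s in the
  weight drops by at most one.\<close>

lemma weight_read:
  fixes K :: "nat \<rightharpoonup> 'a::finite"
  assumes s: "CARD('a) \<ge> 2" and x: "x \<notin> dom K"
  shows "(\<Sum>c\<in>UNIV. weight T (K(x \<mapsto> c)) j w) / real CARD('a) \<le> weight T K j w"
proof (cases "x \<in> {j..<j + length w}")
  case False
  have "weight T (K(x \<mapsto> c)) j w = weight T K j w" for c
  proof -
    have dm: "dom (K(x \<mapsto> c)) = insert x (dom K)" by simp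
    have "T \<inter> {j..<j + length w} - dom (K(x \<mapsto> c)) = T \<inter> {j..<j + length w} - dom K"
      unfolding dm using False by blast
    moreover have "({j..<j + length w} \<subseteq> dom (K(x \<mapsto> c))) = ({j..<j + length w} \<subseteq> dom K)"
      unfolding dm using False by blast
    moreover have "(K(x \<mapsto> c)) (j + i) = K (j + i)" if "i < length w" for i
      using False that by auto
    then have "consistent (K(x \<mapsto> c)) j w \<longleftrightarrow> consistent K j w"
      unfolding consistent_def by simp
    ultimately show ?thesis by (simp only: weight_def)
  qed
  then show ?thesis by simp
next
  case True
  let ?S = "T \<inter> {j..<j + length w} - dom K"
  let ?s = "real CARD('a)"
  have s1: "?s > 1" using s by simp
  show ?thesis
  proof (cases "consistent K j w")
    case con: True
    have nd: "\<not> {j..<j + length w} \<subseteq> dom K" using x True by blast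
    have fin: "finite ?S" by simp
    have le: "card ?S \<le> Suc (card (?S - {x}))"
      by (cases "x \<in> ?S") (use card_Suc_Diff1[OF fin] in auto)
    have "(\<Sum>c\<in>UNIV. weight T (K(x \<mapsto> c)) j w) / ?s
        \<le> (1 / ?s) ^ card (?S - {x}) * (?s / (?s - 1)) / ?s"
      using True x con s by (intro divide_right_mono weight_read_inside) auto
    also have "\<dots> = (1 / ?s) ^ Suc (card (?S - {x})) * (?s / (?s - 1))" by simp
    also have "\<dots> \<le> (1 / ?s) ^ card ?S * (?s / (?s - 1))"
      using le s1 by (intro mult_right_mono power_decreasing) auto
    also have "\<dots> = weight T K j w" using con nd by (simp add: weight_def)
    finally show ?thesis .
  next
    case con: False
    have "weight T (K(x \<mapsto> c)) j w = 0" for c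
      using con consistent_upd[OF x True] by (simp only: weight_def) simp
    then show ?thesis using weight_nonneg[OF s] by simp
  qed
qed

text \<open>Once the sample has been read, a live placement weighs g = s/(s-1), the solution of g =
  1 + g/s, so its weight pays for its own next read.\<close>

lemma weight_check:
  fixes K :: "nat \<rightharpoonup> 'a::finite"
  assumes s: "CARD('a) \<ge> 2" and x: "x \<in> {j..<j + length w} - dom K" and con: "consistent K j w"
    and T: "T \<subseteq> dom K"
  shows "1 + (\<Sum>c\<in>UNIV. weight T (K(x \<mapsto> c)) j w) / real CARD('a) \<le> weight T K j w"
proof -
  let ?s = "real CARD('a)"
  have s1: "?s > 1" using s by simp
  have e: "T \<inter> {j..<j + length w} - dom K = {}" using T by blast
  have "(\<Sum>c\<in>UNIV. weight T (K(x \<mapsto> c)) j w) \<le> ?s / (?s - 1)"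
    using weight_read_inside[OF s x con, of T] unfolding e by simp
  then have "1 + (\<Sum>c\<in>UNIV. weight T (K(x \<mapsto> c)) j w) / ?s \<le> 1 + ?s / (?s - 1) / ?s"
    by (intro add_left_mono divide_right_mono) auto
  also have "\<dots> = ?s / (?s - 1)" using s1 by (simp add: field_simps)
  also have "\<dots> = weight T K j w"
    using con x unfolding weight_def e by auto
  finally show ?thesis .
qed

text \<open>The potential is the number of sample positions still to be read plus the total weight
  of all placements. The first part pays for sampling, one live placement pays for each later read,
  and all other weights do not grow by \<open>weight_read\<close>.\<close>

lemma cost_le_sampling:
  fixes D :: "'a::finite list set"
  assumes s: "CARD('a) \<ge> 2" and T: "T \<subseteq> {..<n}"
  shows "cost n D Map.empty \<le> real (card T)
    + real CARD('a) / (real CARD('a) - 1)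
      * (\<Sum>(j, w)\<in>placements n D. (1 / real CARD('a)) ^ card (T \<inter> {j..<j + length w}))"
proof -
  let ?s = "real CARD('a)"
  let ?W = "\<lambda>K :: nat \<rightharpoonup> 'a. \<Sum>p\<in>placements n D. weight T K (fst p) (snd p)"
  let ?f = "\<lambda>K :: nat \<rightharpoonup> 'a. real (card (T - dom K)) + ?W K"
  have finT: "finite T" using T finite_subset by blast
  have avg: "1 + (\<Sum>c\<in>UNIV. ?f (K(x \<mapsto> c))) / ?s
      = 1 + real (card (T - dom K - {x}))
        + (\<Sum>p\<in>placements n D. (\<Sum>c\<in>UNIV. weight T (K(x \<mapsto> c)) (fst p) (snd p)) / ?s)"
    for K :: "nat \<rightharpoonup> 'a" and x
  proof -
    have "T - dom (K(x \<mapsto> c)) = T - dom K - {x}" for c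
      by (simp only: dom_fun_upd) (simp, blast)
    then have "(\<Sum>c\<in>UNIV. ?f (K(x \<mapsto> c)))
        = (\<Sum>c\<in>(UNIV :: 'a set). real (card (T - dom K - {x}))) + (\<Sum>c\<in>UNIV. ?W (K(x \<mapsto> c)))"
      by (simp only: sum.distrib)
    also have "(\<Sum>c\<in>UNIV. ?W (K(x \<mapsto> c)))
        = (\<Sum>p\<in>placements n D. \<Sum>c\<in>UNIV. weight T (K(x \<mapsto> c)) (fst p) (snd p))"
      by (rule sum.swap)
    finally have e: "(\<Sum>c\<in>UNIV. ?f (K(x \<mapsto> c))) = (\<Sum>c\<in>(UNIV :: 'a set). real (card (T - dom K - {x})))
        + (\<Sum>p\<in>placements n D. \<Sum>c\<in>UNIV. weight T (K(x \<mapsto> c)) (fst p) (snd p))" .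
    show ?thesis unfolding e by (simp add: add_divide_distrib sum_divide_distrib)
  qed
  have "cost n D Map.empty \<le> ?f Map.empty"
  proof (rule cost_le_potential)
    fix K :: "nat \<rightharpoonup> 'a"
    show "0 \<le> ?f K" using weight_nonneg[OF s] by (intro add_nonneg_nonneg sum_nonneg) auto
  next
    fix K :: "nat \<rightharpoonup> 'a" assume nd: "\<not> determined n D K"
    show "\<exists>x\<in>{..<n} - dom K. 1 + (\<Sum>c\<in>UNIV. ?f (K(x \<mapsto> c))) / ?s \<le> ?f K"
    proof (cases "T \<subseteq> dom K")
      case False
      then obtain x where x: "x \<in> T - dom K" by blast
      have "real (card (T - dom K)) = 1 + real (card (T - dom K - {x}))"
        using card_Suc_Diff1[OF _ x] finT by simp
      moreover have "(\<Sum>p\<in>placements n D. (\<Sum>c\<in>UNIV. weight T (K(x \<mapsto> c)) (fst p) (snd p)) / ?s) \<le> ?W K"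
        using x by (intro sum_mono weight_read[OF s]) auto
      ultimately have "1 + (\<Sum>c\<in>UNIV. ?f (K(x \<mapsto> c))) / ?s \<le> ?f K" unfolding avg by linarith
      then show ?thesis using x T by blast
    next
      case True
      obtain j w where p: "(j, w) \<in> placements n D" and con: "consistent K j w"
        and "\<not> {j..<j + length w} \<subseteq> dom K"
        using nd determined_if_checked by metis
      then obtain x where x: "x \<in> {j..<j + length w} - dom K" by blast
      have e: "T - dom K = {}" using True by blast
      let ?P = "placements n D - {(j, w)}"
      have rem: "(\<Sum>p\<in>placements n D. g p) = g (j, w) + (\<Sum>p\<in>?P. g p)" for g :: "_ \<Rightarrow> real"
        by (rule sum.remove[OF finite_placements p])
      have "1 + (\<Sum>c\<in>UNIV. ?f (K(x \<mapsto> c))) / ?s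
          = (1 + (\<Sum>c\<in>UNIV. weight T (K(x \<mapsto> c)) j w) / ?s)
            + (\<Sum>p\<in>?P. (\<Sum>c\<in>UNIV. weight T (K(x \<mapsto> c)) (fst p) (snd p)) / ?s)"
        unfolding avg unfolding e rem by simp
      also have "\<dots> \<le> weight T K j w + (\<Sum>p\<in>?P. weight T K (fst p) (snd p))"
        using x by (intro add_mono weight_check[OF s x con True] sum_mono weight_read[OF s]) auto
      also have "\<dots> = ?f K"
        unfolding e rem by simp
      finally show ?thesis using x p by (intro bexI[of _ x]) (auto simp: placements_def)
    qed
  qed
  also have "\<dots> \<le> real (card T) + (\<Sum>p\<in>placements n D.
      ?s / (?s - 1) * (1 / ?s) ^ card (T \<inter> {fst p..<fst p + length (snd p)}))"
    using s by (intro add_mono sum_mono) (auto simp: weight_def mult.commute)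
  finally show ?thesis by (simp add: sum_distrib_left case_prod_unfold)
qed

text \<open>
  Positions are sampled with the rational density \<open>p/q\<close> along a discretised line. A window of
  length \<open>m\<close> then contains \<open>\<lfloor>pm/q\<rfloor>\<close> or \<open>\<lfloor>pm/q\<rfloor> + 1\<close> of them, and averaging over the phases
  \<open>t < q\<close> interpolates linearly between the two.
\<close>

lemma sum_shift_mod:
  fixes g :: "nat \<Rightarrow> 'b::comm_monoid_add"
  assumes "q > 0"
  shows "(\<Sum>t<q. g ((a + t) mod q)) = (\<Sum>u<q. g u)"
proof -
  have inj: "inj_on (\<lambda>t. (a + t) mod q) {..<q}"
  proof (rule linorder_inj_onI')
    fix t t' assume t: "t \<in> {..<q}" "t' \<in> {..<q}" "t < t'"
    show "(a + t) mod q \<noteq> (a + t') mod q"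
    proof
      assume "(a + t) mod q = (a + t') mod q"
      then have "q dvd (a + t') - (a + t)" using t by (subst mod_eq_dvd_iff_nat[symmetric]) auto
      then show False using t by (auto dest!: dvd_imp_le)
    qed
  qed
  moreover have "(\<lambda>t. (a + t) mod q) ` {..<q} = {..<q}"
    using assms by (intro endo_inj_surj inj) auto
  ultimately have "bij_betw (\<lambda>t. (a + t) mod q) {..<q} {..<q}" by (simp add: bij_betw_def)
  then show ?thesis by (rule sum.reindex_bij_betw)
qed

text \<open>Hermite's identity for the floor function. Increasing \<open>N\<close> by 1 shifts the
  range of summation, exchanging \<open>N div q\<close> for \<open>(N + q) div q\<close>.\<close>

lemma sum_div_shift: "q > 0 \<Longrightarrow> (\<Sum>u<q. (u + N) div q) = (N :: nat)"
proof (induction N)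
  case (Suc N)
  have "(\<Sum>u<q. (u + Suc N) div q) + N div q = (\<Sum>u<Suc q. (u + N) div q)"
    unfolding sum.lessThan_Suc_shift by (simp add: add.commute)
  also have "\<dots> = N + (N div q + 1)" using Suc by (simp add: div_add_self1)
  finally show ?case by simp
qed simp

text \<open>Sampled positions are the jumps of the discretised line. As \<open>p \<le> q\<close>, a
  jump has height 1, so counting them in a window telescopes.\<close>

lemma card_line_samples:
  fixes p q t :: nat
  assumes "p \<le> q" "q > 0"
  shows "(p * (j + m) + t) div q
    = (p * j + t) div q + card {x \<in> {j..<j + m}. (p * x + t) div q < (p * Suc x + t) div q}"
proof (induction m)
  case (Suc m)
  let ?P = "\<lambda>x. (p * x + t) div q < (p * Suc x + t) div q"
  have "(p * Suc (j + m) + t) div q \<le> (p * (j + m) + t + q) div q"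
    using assms(1) by (intro div_le_mono) simp
  also have "\<dots> = (p * (j + m) + t) div q + 1" using assms(2) by (simp add: div_add_self2)
  finally have up: "(p * Suc (j + m) + t) div q \<le> (p * (j + m) + t) div q + 1" .
  have lo: "(p * (j + m) + t) div q \<le> (p * Suc (j + m) + t) div q" by (intro div_le_mono) simp
  have "{x \<in> {j..<j + Suc m}. ?P x} = {x \<in> {j..<j + m}. ?P x} \<union> (if ?P (j + m) then {j + m} else {})"
    by (auto simp: less_Suc_eq)
  then have "card {x \<in> {j..<j + Suc m}. ?P x}
      = card {x \<in> {j..<j + m}. ?P x} + (if ?P (j + m) then 1 else 0)"
    by (auto simp: card_insert_if)
  then show ?case using up lo Suc by (auto split: if_splits)
qed simp

text \<open>Sum of the sampling bound over all \<open>q\<close> phases \<open>t\<close>. For a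
  window starting at \<open>j\<close> the offset \<open>(p * j + t) mod q\<close> runs through all
  residues, so the sum depends only on the length of the window.\<close>

lemma cost_le_line_sampling:
  fixes D :: "'a::finite list set"
  assumes s: "CARD('a) \<ge> 2" and pq: "p \<le> q" "q > 0"
  shows "real q * cost n D Map.empty \<le> real n * real p
    + real CARD('a) / (real CARD('a) - 1)
      * (\<Sum>(j, w)\<in>placements n D. \<Sum>u<q. (1 / real CARD('a)) ^ ((u + p * length w) div q))"
proof -
  let ?s = "real CARD('a)"
  define T where "T t = {x \<in> {..<n}. (p * x + t) div q < (p * Suc x + t) div q}" for t
  have cardT: "card (T t \<inter> {j..<j + m}) = ((p * j + t) mod q + p * m) div q" if "j + m \<le> n" for t j m
  proof -
    have "T t \<inter> {j..<j + m} = {x \<in> {j..<j + m}. (p * x + t) div q < (p * Suc x + t) div q}"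
      using that by (auto simp: T_def)
    then have "(p * j + t) div q + card (T t \<inter> {j..<j + m}) = (p * (j + m) + t) div q"
      using card_line_samples[OF pq] by simp
    also have "p * (j + m) + t = (p * j + t) div q * q + ((p * j + t) mod q + p * m)"
      by (simp add: algebra_simps)
    also have "\<dots> div q = (p * j + t) div q + ((p * j + t) mod q + p * m) div q"
      using pq(2) by (subst div_mult_self3) auto
    finally show ?thesis by simp
  qed
  have total: "(\<Sum>t<q. real (card (T t))) = real n * real p"
  proof -
    have "card (T t) = (t mod q + p * n) div q" for t
      using cardT[of 0 n t] by (simp add: T_def Int_absorb2 subset_eq)
    then have "(\<Sum>t<q. card (T t)) = (\<Sum>t<q. (t + p * n) div q)" by simp
    also have "\<dots> = p * n" using pq(2) by (rule sum_div_shift)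
    finally show ?thesis by (simp flip: of_nat_sum of_nat_mult add: mult.commute)
  qed
  have "real q * cost n D Map.empty = (\<Sum>t<q. cost n D Map.empty)" by simp
  also have "\<dots> \<le> (\<Sum>t<q. real (card (T t)) + ?s / (?s - 1)
      * (\<Sum>(j, w)\<in>placements n D. (1 / ?s) ^ card (T t \<inter> {j..<j + length w})))"
    by (intro sum_mono cost_le_sampling[OF s]) (auto simp: T_def)
  also have "\<dots> = real n * real p + ?s / (?s - 1)
      * (\<Sum>(j, w)\<in>placements n D. \<Sum>t<q. (1 / ?s) ^ card (T t \<inter> {j..<j + length w}))"
    unfolding sum.distrib total sum_distrib_left[symmetric] case_prod_unfold
    by (subst sum.swap) (rule refl)
  also have "(\<Sum>(j, w)\<in>placements n D. \<Sum>t<q. (1 / ?s) ^ card (T t \<inter> {j..<j + length w}))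
      = (\<Sum>(j, w)\<in>placements n D. \<Sum>u<q. (1 / ?s) ^ ((u + p * length w) div q))"
  proof (intro sum.cong refl, clarify)
    fix j w assume "(j, w) \<in> placements n D"
    then have "j + length w \<le> n" by (simp add: placements_def)
    then show "(\<Sum>t<q. (1 / ?s) ^ card (T t \<inter> {j..<j + length w}))
        = (\<Sum>u<q. (1 / ?s) ^ ((u + p * length w) div q))"
      using sum_shift_mod[OF pq(2), of "\<lambda>u. (1 / ?s) ^ ((u + p * length w) div q)" "p * j"]
      by (simp add: cardT)
  qed
  finally show ?thesis .
qed

lemma sum_power_div:
  fixes z :: real
  assumes "q > 0"
  shows "(\<Sum>u<q. z ^ ((u + N) div q))
    = z ^ (N div q) * (real q - real (N mod q) * (1 - z))"
proof -
  let ?a = "N div q" and ?f = "N mod q"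
  have f: "?f < q" using assms by simp
  have eq: "(u + N) div q = ?a + (if u < q - ?f then 0 else 1)" if "u < q" for u
  proof -
    have "u + N = ?a * q + (u + ?f)" by simp
    then have "(u + N) div q = ?a + (u + ?f) div q"
      using assms by (metis div_mult_self3 less_numeral_extra(3))
    moreover have "(u + ?f) div q = (if u < q - ?f then 0 else 1)"
      using that f by (auto simp: div_eq_0_iff less_diff_conv not_less intro!: div_nat_eqI add_strict_mono)
    ultimately show ?thesis by simp
  qed
  have "(\<Sum>u<q. z ^ ((u + N) div q)) = (\<Sum>u<q. z ^ ?a * (if u < q - ?f then 1 else z))"
    by (intro sum.cong) (auto simp: eq)
  also have "\<dots> = z ^ ?a * ((\<Sum>u\<in>{..<q} \<inter> {u. u < q - ?f}. 1) + (\<Sum>u\<in>{..<q} \<inter> - {u. u < q - ?f}. z))"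
    unfolding sum_distrib_left[symmetric] by (subst sum.If_cases) auto
  also have "{..<q} \<inter> {u. u < q - ?f} = {..<q - ?f}" by auto
  also have "{..<q} \<inter> - {u. u < q - ?f} = {q - ?f..<q}" by auto
  finally show ?thesis using f by (simp add: of_nat_diff algebra_simps)
qed

text \<open>For \<open>s \<ge> 2\<close> this says s^(1/(s-1)) \<le> 2, with equality at s = 2; this
  is the source of the 2 in the constant \<open>2 s / e\<close> of the survival bound.\<close>

lemma ln_le_two_power: "s \<ge> (1::nat) \<Longrightarrow> ln (real s) \<le> (real s - 1) * ln 2"
proof -
  assume s: "s \<ge> 1"
  have "s \<le> 2 ^ (s - 1)" using s
  proof (induction s rule: dec_induct)
    case (step n)
    then show ?case by (cases n) auto
  qed simp
  then have "real s \<le> 2 ^ (s - 1)" by (metis of_nat_le_iff of_nat_numeral of_nat_power)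
  then have "ln (real s) \<le> ln (2 ^ (s - 1))" using s by (subst ln_le_cancel_iff) auto
  also have "\<dots> = (real s - 1) * ln 2" using s by (simp add: ln_realpow of_nat_diff)
  finally show ?thesis .
qed

text \<open>Besides \<open>(1 / s) ^ a\<close> for the integer part \<open>a\<close> of
  \<open>N / q\<close>, the phase sum contributes a factor linear in the fractional part
  \<open>y\<close>. It is bounded by a multiple of \<open>exp (- L * y)\<close>, so the decay is
  exponential in the exact ratio \<open>N / q\<close>.\<close>

lemma line_sampling_survival:
  fixes s :: nat
  assumes s: "s \<ge> 2" and q: "q > 0"
  shows "ln (real s) * (real s / (real s - 1)) * (\<Sum>u<q. (1 / real s) ^ ((u + N) div q))
    \<le> real q * (2 * real s / exp 1 * exp (- (ln (real s) * (real N / real q))))"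
proof -
  let ?s = "real s"
  define L where "L = ln ?s"
  define y where "y = real (N mod q) / real q"
  define a where "a = N div q"
  have s1: "?s > 1" "?s - 1 > 0" using s by auto
  have fy: "real (N mod q) = y * real q" using q by (simp add: y_def)
  have Nq: "real N / real q = real a + y"
  proof -
    have "real N = real a * real q + real (N mod q)"
      unfolding a_def by (metis div_mult_mod_eq of_nat_add of_nat_mult)
    then show ?thesis using q unfolding y_def by (simp add: field_simps)
  qed
  \<comment> \<open>The bound z \<le> exp (z - 1) converts the linear factor into an exponential
    one.\<close>
  have "L * (?s / (?s - 1) - y) \<le> exp (L * (?s / (?s - 1) - y) - 1)"
    using exp_ge_add_one_self[of "L * (?s / (?s - 1) - y) - 1"] by simp
  also have "L * (?s / (?s - 1) - y) - 1 = L + L / (?s - 1) - 1 - L * y"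
    using s1 by (simp add: field_simps)
  also have "exp \<dots> = ?s * exp (L / (?s - 1)) / exp 1 * exp (- (L * y))"
  proof -
    have "exp L = ?s" using s1 by (simp add: L_def)
    then show ?thesis by (simp only: exp_diff exp_add exp_minus) (simp add: divide_inverse)
  qed
  also have "\<dots> \<le> ?s * 2 / exp 1 * exp (- (L * y))"
  proof -
    have "L / (?s - 1) \<le> ln 2"
      using ln_le_two_power[of s] s s1 unfolding L_def by (simp add: field_simps)
    then have "exp (L / (?s - 1)) \<le> 2" by (metis exp_le_cancel_iff exp_ln zero_less_numeral)
    then show ?thesis by (intro mult_right_mono divide_right_mono mult_left_mono) auto
  qed
  finally have main: "L * (?s / (?s - 1) - y) \<le> 2 * ?s / exp 1 * exp (- (L * y))"
    by (simp add: mult.commute)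
  have "L * (?s / (?s - 1)) * (\<Sum>u<q. (1 / ?s) ^ ((u + N) div q))
      = L * (?s / (?s - 1)) * ((1 / ?s) ^ a * (real q * (1 - y * (1 - 1 / ?s))))"
    unfolding sum_power_div[OF q] fy a_def[symmetric] by (simp add: algebra_simps)
  also have "\<dots> = real q * ((1 / ?s) ^ a * (L * (?s / (?s - 1) - y)))"
    using s1 by (simp add: field_simps)
  also have "\<dots> \<le> real q * ((1 / ?s) ^ a * (2 * ?s / exp 1 * exp (- (L * y))))"
    using main s1 by (intro mult_left_mono) auto
  also have "(1 / ?s) ^ a * (2 * ?s / exp 1 * exp (- (L * y)))
      = 2 * ?s / exp 1 * exp (- (L * (real N / real q)))"
  proof -
    have "(1 / ?s) ^ a = exp (- L) ^ a" using s1 by (simp add: L_def exp_minus inverse_eq_divide)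
    also have "\<dots> = exp (- (L * real a))" by (simp add: exp_of_nat_mult[symmetric] mult.commute)
    finally have "(1 / ?s) ^ a * exp (- (L * y)) = exp (- (L * (real N / real q)))"
      unfolding Nq by (simp only: exp_add[symmetric]) (simp add: algebra_simps)
    from this[symmetric] show ?thesis by (simp only: mult_ac)
  qed
  finally show ?thesis by (simp add: L_def)
qed

lemma sum_placements_le:
  fixes D :: "'a::finite list set" and g :: "nat \<Rightarrow> real"
  assumes min: "\<And>w. w \<in> D \<Longrightarrow> M \<le> length w" and M: "M > 0" and g: "\<And>m. 0 \<le> g m"
  shows "(\<Sum>(j, w)\<in>placements n D. g (length w)) \<le> real n * (\<Sum>m=M..n. real (content D m) * g m)"
proof -
  define E where "E = {w \<in> D. length w \<le> n}"
  have fin: "finite E"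
    by (rule finite_subset[OF _ finite_lists_length_le[of "UNIV :: 'a set" n]]) (auto simp: E_def)
  have sub: "placements n D \<subseteq> {..<n} \<times> E"
  proof clarify
    fix j w assume "(j, w) \<in> placements n D"
    then show "j \<in> {..<n} \<and> w \<in> E"
      using min[of w] M by (auto simp: placements_def E_def)
  qed
  have "(\<Sum>(j, w)\<in>placements n D. g (length w)) \<le> (\<Sum>(j, w)\<in>{..<n} \<times> E. g (length w))"
    using fin sub g by (intro sum_mono2) auto
  also have "\<dots> = real n * (\<Sum>w\<in>E. g (length w))"
    by (simp add: sum.cartesian_product[symmetric])
  also have "(\<Sum>w\<in>E. g (length w)) = (\<Sum>m=M..n. \<Sum>w\<in>{w \<in> E. length w = m}. g (length w))"
    using fin min by (intro sum.group[symmetric]) (auto simp: E_def)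
  also have "\<dots> = (\<Sum>m=M..n. real (content D m) * g m)"
  proof (intro sum.cong refl)
    fix m assume "m \<in> {M..n}"
    then have "{w \<in> E. length w = m} = {w \<in> D. length w = m}" by (auto simp: E_def)
    then show "(\<Sum>w\<in>{w \<in> E. length w = m}. g (length w)) = real (content D m) * g m"
      by (simp add: content_def)
  qed
  finally show ?thesis .
qed

lemma content_pos:
  assumes "w \<in> (D :: 'a::finite list set)"
  shows "content D (length w) \<ge> 1"
proof -
  have "finite {v \<in> D. length v = length w}"
    by (rule finite_subset[of _ "words (length w)"]) (auto simp: words_def finite_words[unfolded words_def])
  then have "card {v \<in> D. length v = length w} > 0" using assms by (subst card_gt_0_iff) auto
  then show ?thesis by (simp add: content_def)
qed

text \<open>With x = e^(-t), each length m contributes at most a constant times x^m / M by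
  \<open>growth\<close>. The geometric sum from M on is at most x^M / (1 - x), and \<open>tM\<close>
  is what makes the remaining constant (2/e) / (M (1 - x)) at most 1.\<close>

lemma Phi_le_sampling_density:
  fixes D :: "'a::finite list set"
  defines "s \<equiv> real CARD('a)"
  assumes s2: "CARD('a) \<ge> 2" and M: "M > 0" "content D M \<ge> 1"
    and min: "\<And>m. content D m \<ge> 1 \<Longrightarrow> M \<le> m"
    and growth: "\<And>m. content D m \<ge> 1 \<Longrightarrow> s * real m * real (content D m) \<le> exp (t * real m)"
    and t: "t > 0" and pq: "p \<le> q" "q > 0" and dens: "2 * t = ln s * (real p / real q)"
    and tM: "2 / exp 1 \<le> real M * (1 - exp (- t))"
  shows "Phi D \<le> 2 * t + 1 / (s * real M)"
proof (rule Phi_le)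
  fix n :: nat assume n: "n > 0"
  define x where "x = exp (- t)"
  have s: "s > 1" using s2 by (simp add: s_def)
  have x: "0 < x" "x < 1" using t by (simp_all add: x_def)
  let ?S = "\<Sum>(j, w)\<in>placements n D. \<Sum>u<q. (1 / s) ^ ((u + p * length w) div q)"
  have "ln s * (s / (s - 1)) * ?S
      = (\<Sum>(j, w)\<in>placements n D. ln s * (s / (s - 1)) * (\<Sum>u<q. (1 / s) ^ ((u + p * length w) div q)))"
    unfolding sum_distrib_left case_prod_unfold ..
  also have "\<dots> \<le> (\<Sum>(j, w)\<in>placements n D. real q * (2 * s / exp 1 * exp (- (2 * t * real (length w)))))"
  proof (intro sum_mono, clarify)
    fix j :: nat and w :: "'a list"
    have "ln s * (real (p * length w) / real q) = 2 * t * real (length w)"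
      using dens by simp
    then show "ln s * (s / (s - 1)) * (\<Sum>u<q. (1 / s) ^ ((u + p * length w) div q))
        \<le> real q * (2 * s / exp 1 * exp (- (2 * t * real (length w))))"
      using line_sampling_survival[OF s2 pq(2), of "p * length w"] unfolding s_def by simp
  qed
  also have "\<dots> \<le> real n * (\<Sum>m=M..n. real (content D m)
      * (real q * (2 * s / exp 1 * exp (- (2 * t * real m)))))"
    using content_pos min s M(1) by (intro sum_placements_le) auto
  also have "\<dots> \<le> real n * (\<Sum>m=M..n. real q * (2 / exp 1) * (x ^ m / real M))"
  proof (intro mult_left_mono sum_mono)
    fix m assume m: "m \<in> {M..n}"
    show "real (content D m) * (real q * (2 * s / exp 1 * exp (- (2 * t * real m))))
        \<le> real q * (2 / exp 1) * (x ^ m / real M)"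
    proof (cases "content D m \<ge> 1")
      case True
      have m0: "real m > 0" using m M(1) by auto
      have "real (content D m) * s * exp (- (2 * t * real m))
          = (s * real m * real (content D m)) * exp (- (2 * t * real m)) / real m"
        using m0 by simp
      also have "\<dots> \<le> exp (t * real m) * exp (- (2 * t * real m)) / real m"
        using growth[OF True] by (intro divide_right_mono mult_right_mono) auto
      also have "exp (t * real m) * exp (- (2 * t * real m)) = exp (- (t * real m))"
        by (simp only: exp_add[symmetric]) simp
      also have "\<dots> = x ^ m" by (simp add: x_def exp_of_nat_mult[symmetric] mult.commute)
      also have "x ^ m / real m \<le> x ^ m / real M"
        using m M(1) x by (intro divide_left_mono) auto
      finally have "(real q * (2 / exp 1)) * (real (content D m) * s * exp (- (2 * t * real m)))
          \<le> (real q * (2 / exp 1)) * (x ^ m / real M)" by (intro mult_left_mono) auto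
      then show ?thesis by (simp add: mult_ac)
    next
      case False
      then have "content D m = 0" by simp
      then show ?thesis using x by simp
    qed
  qed simp
  also have "\<dots> = real n * (real q * (2 / exp 1) * ((\<Sum>m=M..n. x ^ m) / real M))"
    by (simp add: sum_distrib_left sum_divide_distrib)
  also have "\<dots> \<le> real n * (real q * (2 / exp 1) * (x ^ M / (1 - x) / real M))"
  proof -
    have "(\<Sum>m=M..n. x ^ m) \<le> x ^ M / (1 - x)"
      using x by (auto simp: sum_gp divide_right_mono)
    then show ?thesis by (intro mult_left_mono divide_right_mono) auto
  qed
  also have "real q * (2 / exp 1) * (x ^ M / (1 - x) / real M) \<le> real q * (1 / (s * real M))"
  proof -
    \<comment> \<open>Second use of \<open>growth\<close>, now at the minimal length: it bounds x^M
      by 1/(s M), the additive term of the conclusion.\<close>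
    have "s * real M * 1 \<le> s * real M * real (content D M)" using M s by (intro mult_left_mono) auto
    also have "\<dots> \<le> exp (t * real M)" by (rule growth[OF M(2)])
    finally have "s * real M * x ^ M \<le> exp (t * real M) * x ^ M" using x by (intro mult_right_mono) auto
    also have "\<dots> = exp (t * real M) * exp (- (t * real M))"
      by (simp add: x_def exp_of_nat_mult[symmetric] mult.commute)
    also have "\<dots> = 1" by (simp only: exp_add[symmetric]) simp
    finally have xM: "x ^ M \<le> 1 / (s * real M)" using s M(1) by (simp add: field_simps)
    have "2 / exp 1 * (x ^ M / (1 - x) / real M) = (2 / exp 1) / (real M * (1 - x)) * x ^ M"
      by (simp add: field_simps)
    also have "\<dots> \<le> 1 * (1 / (s * real M))"
      using tM x M(1) xM by (intro mult_mono) (auto simp: x_def divide_le_eq mult.commute)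
    finally have "2 / exp 1 * (x ^ M / (1 - x) / real M) \<le> 1 * (1 / (s * real M))" .
    from mult_left_mono[OF this, of "real q"] show ?thesis by (simp add: mult.assoc)
  qed
  finally have S: "ln s * (s / (s - 1)) * ?S \<le> real n * (real q * (1 / (s * real M)))"
    by (simp add: mult_left_mono)
  have ln0: "0 \<le> ln s" using s by simp
  have "real q * (ln s * cost n D Map.empty) \<le> ln s * (real n * real p + s / (s - 1) * ?S)"
    using mult_left_mono[OF cost_le_line_sampling[OF s2 pq, of n D] ln0]
    unfolding s_def by (simp add: mult_ac)
  also have "\<dots> = real n * (ln s * real p) + ln s * (s / (s - 1)) * ?S" by (simp add: algebra_simps)
  also have "ln s * real p = real q * (2 * t)" using dens pq(2) by simp
  also have "real n * (real q * (2 * t)) + ln s * (s / (s - 1)) * ?S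
      \<le> real n * (real q * (2 * t)) + real n * (real q * (1 / (s * real M)))"
    using S by simp
  also have "\<dots> = real q * (real n * (2 * t + 1 / (s * real M)))" by (simp add: algebra_simps)
  finally have "ln s * cost n D Map.empty \<le> real n * (2 * t + 1 / (s * real M))"
    using pq(2) by simp
  then show "ln (real CARD('a)) * (cost n D Map.empty / real n) \<le> 2 * t + 1 / (s * real M)"
    using n unfolding s_def by (simp add: divide_le_eq mult.commute)
qed

section \<open>Choosing the sampling density in terms of \<open>phi\<close>\<close>

lemma m_min_props:
  assumes "\<exists>m. r m > 0"
  shows "r (m_min r) \<ge> 1" and "\<And>m. r m \<ge> 1 \<Longrightarrow> m_min r \<le> m"
proof -
  show "r (m_min r) \<ge> 1"
    using assms unfolding m_min_def by (metis (mono_tags, lifting) LeastI Suc_leI One_nat_def)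
  show "m_min r \<le> m" if "r m \<ge> 1" for m
    using that unfolding m_min_def by (intro Least_le) simp
qed

text \<open>The point is that the supremum is finite: \<open>r m \<le> s ^ m\<close> bounds every
  term by \<open>2 * ln s + 1\<close>.\<close>

lemma phi_upper:
  assumes s: "s \<ge> 2" and r0: "r 0 = 0" and r: "\<And>m. r m \<le> s ^ m" and m: "r m \<ge> 1"
  shows "1 / real m * ln (real s * real m * real (r m)) \<le> phi s r"
  unfolding phi_def
proof (rule cSUP_upper)
  show "m \<in> {m. r m \<ge> 1}" using m by simp
  show "bdd_above ((\<lambda>m. 1 / real m * ln (real s * real m * real (r m))) ` {m. r m \<ge> 1})"
  proof (rule bdd_aboveI2)
    fix m assume "m \<in> {m. r m \<ge> 1}"
    then have m: "real m \<ge> 1" "real (r m) > 0" using r0 by (cases m, auto)+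
    have s0: "real s > 0" "ln (real s) \<ge> 0" using s by auto
    have "real (r m) \<le> real s ^ m" using r[of m] by (metis of_nat_le_iff of_nat_power)
    then have "ln (real (r m)) \<le> ln (real s ^ m)" using m s0 by (subst ln_le_cancel_iff) auto
    also have "\<dots> = real m * ln (real s)" using s0 by (simp add: ln_realpow)
    finally have "ln (real s * real m * real (r m)) \<le> ln (real s) + ln (real m) + real m * ln (real s)"
      using m s0 by (simp add: ln_mult)
    also have "\<dots> \<le> real m * ln (real s) + real m + real m * ln (real s)"
    proof -
      have "ln (real m) \<le> real m" using m ln_le_minus_one[of "real m"] by linarith
      moreover have "ln (real s) \<le> real m * ln (real s)"
        using m(1) s0(2) mult_right_mono[of 1 "real m" "ln (real s)"] by simp
      ultimately show ?thesis by linarith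
    qed
    also have "\<dots> = real m * (2 * ln (real s) + 1)" by (simp add: algebra_simps)
    finally show "1 / real m * ln (real s * real m * real (r m)) \<le> 2 * ln (real s) + 1"
      using m by (simp add: divide_le_eq mult.commute)
  qed
qed

text \<open>Here 1 - e^(-t) \<ge> t/(1+t), and M t/(1+t) \<ge> 4/5 > 2/e follows from M t \<ge> ln 4
  \<ge> 4/3 and M \<ge> 2.\<close>

lemma growth_constant_bound:
  assumes "s \<ge> 2" "M \<ge> 2" and t: "ln (real s * real M) \<le> t * real M"
  shows "2 / exp 1 \<le> real M * (1 - exp (- t))"
proof -
  have e: "exp 1 \<ge> (5 / 2 :: real)"
    using exp_lower_Taylor_quadratic[of 1] by (simp add: power2_eq_square)
  have sM: "(2::real) * 2 \<le> real s * real M" using assms(1,2) by (intro mult_mono) auto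
  have "4 / 3 \<le> ln (2 * 2 :: real)" using ln2_ge_two_thirds by (subst ln_mult) auto
  also have "\<dots> \<le> ln (real s * real M)" using sM by (subst ln_le_cancel_iff) auto
  finally have tM: "4 / 3 \<le> t * real M" using t by linarith
  have t0: "t > 0"
  proof (rule ccontr)
    assume "\<not> t > 0"
    then have "t * real M \<le> 0" by (intro mult_nonpos_nonneg) auto
    with tM show False by linarith
  qed
  have "2 / exp 1 \<le> (4 / 5 :: real)" using e by (simp add: divide_le_eq)
  also have "4 / 5 \<le> real M * (t / (1 + t))"
  proof -
    have "4 * (1 + t) \<le> 5 * (t * real M)"
    proof -
      have "t * 2 \<le> t * real M" using assms(2) t0 by (intro mult_left_mono) auto
      moreover have "4 * (1 + t) \<le> 5 * X" if "t * 2 \<le> X" "4 / 3 \<le> X" for X using that by simp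
      ultimately show ?thesis using tM by blast
    qed
    then show ?thesis using t0 by (simp add: le_divide_eq algebra_simps)
  qed
  also have "\<dots> \<le> real M * (1 - exp (- t))"
  proof (intro mult_left_mono)
    have "exp (- t) \<le> 1 / (1 + t)"
      using exp_ge_add_one_self[of t] t0 by (simp add: exp_minus inverse_eq_divide frac_le)
    then show "t / (1 + t) \<le> 1 - exp (- t)" using t0 by (simp add: field_simps)
  qed simp
  finally show ?thesis .
qed

text \<open>Arguing by contradiction leaves a gap in which a rational density \<alpha> = p/q fits,
  slightly above \<open>2 * phi / ln s\<close>. The trivial bound \<open>Phi_le_ln\<close> forces
  \<alpha> < 1, so that \<open>p \<le> q\<close>.\<close>

lemma Phi_le_phi:
  fixes D :: "'a::finite list set"
  assumes s: "CARD('a) \<ge> 2" and r: "content D = r" "r 0 = 0" "\<And>m. r m \<le> CARD('a) ^ m" "\<exists>m. r m > 0"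
    and M: "m_min r \<ge> 2"
  shows "Phi D \<le> 2 * phi CARD('a) r + 1 / (real CARD('a) * real (m_min r))"
proof (rule ccontr)
  let ?s = "real CARD('a)" and ?M = "m_min r" and ?\<phi> = "phi CARD('a) r"
  assume "\<not> ?thesis"
  then have big: "2 * ?\<phi> < Phi D - 1 / (?s * real ?M)" by simp
  have L: "ln ?s > 0" using s by simp
  note up = phi_upper[OF s r(2,3)]
  have upM: "ln (?s * real m * real (r m)) \<le> ?\<phi> * real m" if "r m \<ge> 1" for m
  proof -
    have "m > 0" using that r(2) by (cases m) auto
    then show ?thesis using up[OF that] by (simp add: divide_le_eq)
  qed
  have "?s * real ?M * 1 \<le> ?s * real ?M * real (r ?M)"
    using m_min_props(1)[OF r(4)] by (intro mult_left_mono) auto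
  then have "ln (?s * real ?M) \<le> ln (?s * real ?M * real (r ?M))"
    using s M by (intro ln_mono) auto
  with upM[OF m_min_props(1)[OF r(4)]] have lnM: "ln (?s * real ?M) \<le> ?\<phi> * real ?M" by linarith
  have "1 < ?s * real ?M" using mult_mono[of 2 ?s 2 "real ?M"] s M by simp
  then have "0 < ln (?s * real ?M)" by simp
  with lnM have "0 < ?\<phi> * real ?M" by linarith
  then have \<phi>0: "?\<phi> > 0" using M by (simp add: zero_less_mult_iff)
  have "Phi D - 1 / (?s * real ?M) \<le> ln ?s" using Phi_le_ln[of D] s M
    by (smt (verit) divide_nonneg_nonneg mult_nonneg_nonneg of_nat_0_le_iff)
  moreover obtain \<alpha> where \<alpha>: "\<alpha> \<in> \<rat>" "2 * ?\<phi> / ln ?s < \<alpha>" "\<alpha> < (Phi D - 1 / (?s * real ?M)) / ln ?s"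
    using Rats_dense_in_real[of "2 * ?\<phi> / ln ?s" "(Phi D - 1 / (?s * real ?M)) / ln ?s"] big L
    by (auto simp: divide_strict_right_mono)
  ultimately have "\<alpha> < 1" using L by (smt (verit) divide_le_eq_1_pos)
  have "\<alpha> > 0" using \<alpha>(2) \<phi>0 L by (smt (verit) divide_pos_pos)
  obtain p q :: nat where pq: "q \<noteq> 0" "\<bar>\<alpha>\<bar> = real p / real q"
    using Rats_abs_nat_div_natE[OF \<alpha>(1)] by metis
  have \<alpha>pq: "\<alpha> = real p / real q" using pq \<open>\<alpha> > 0\<close> by simp
  have "p \<le> q" using \<open>\<alpha> < 1\<close> pq(1) unfolding \<alpha>pq by (simp add: divide_less_eq)
  define t where "t = ln ?s * \<alpha> / 2"
  have t: "?\<phi> < t" using \<alpha>(2) L by (simp add: t_def divide_less_eq mult.commute)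
  have "Phi D \<le> 2 * t + 1 / (?s * real ?M)"
  proof (rule Phi_le_sampling_density)
    show "CARD('a) \<ge> 2" "p \<le> q" "q > 0" "?M > 0" "t > 0"
      using s \<open>p \<le> q\<close> pq M t \<phi>0 by auto
    show "content D ?M \<ge> 1" using m_min_props(1)[OF r(4)] r(1) by simp
    show "?M \<le> m" if "content D m \<ge> 1" for m
      using m_min_props(2)[OF r(4)] that r(1) by simp
    show "2 * t = ln ?s * (real p / real q)" by (simp add: t_def \<alpha>pq)
    show "?s * real m * real (content D m) \<le> exp (t * real m)" if "content D m \<ge> 1" for m
    proof -
      have rm: "r m \<ge> 1" using that r(1) by simp
      then have "m > 0" using r(2) by (cases m) auto
      then have pos: "?s * real m * real (r m) > 0" using s rm by simp
      have "ln (?s * real m * real (r m)) \<le> t * real m"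
        using upM[OF rm] t mult_right_mono[of ?\<phi> t "real m"] by simp
      then show ?thesis using pos r(1) by (metis exp_le_cancel_iff exp_ln)
    qed
    have "ln (?s * real ?M) \<le> t * real ?M"
      using lnM t mult_right_mono[of ?\<phi> t "real ?M"] by simp
    then show "2 / exp 1 \<le> real ?M * (1 - exp (- t))" using growth_constant_bound s M by blast
  qed
  moreover have "2 * t < Phi D - 1 / (?s * real ?M)"
    using \<alpha>(3) L by (simp add: t_def less_divide_eq mult.commute)
  ultimately show False by simp
qed

section \<open>Lower bound: counting the dictionaries that admit a short certificate\<close>

text \<open>Two completions disagree: one carries \<open>w\<close> at \<open>j\<close>, the other
  differs from it only by a wrong character at the unread position \<open>y\<close>.\<close>

lemma not_determined_if_unchecked:
  fixes K :: "nat \<rightharpoonup> 'a::finite"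
  assumes s: "CARD('a) \<ge> 2" and d: "dom K \<subseteq> {..<n}" and p: "w \<in> D" "j + length w \<le> n"
    and con: "consistent K j w" and y: "y \<in> {j..<j + length w} - dom K"
  shows "\<not> determined n D K"
proof
  assume det: "determined n D K"
  obtain \<zeta> where \<zeta>: "\<zeta> \<in> words n" "agrees K \<zeta>" using completion_exists[OF d] by blast
  obtain c where c: "c \<noteq> w ! (y - j)"
  proof -
    have "UNIV \<noteq> {w ! (y - j)}"
    proof
      assume "UNIV = {w ! (y - j)}"
      then have "CARD('a) = card {w ! (y - j)}" by (rule arg_cong)
      then show False using s by simp
    qed
    then show ?thesis using that by blast
  qed
  define \<xi> where "\<xi> = map (\<lambda>x. if x \<in> {j..<j + length w} then w ! (x - j) else \<zeta> ! x) [0..<n]"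
  have y': "j \<le> y" "y < j + length w" "y < n" "K y = None" using y p(2) by auto
  have "agrees K \<xi>"
    unfolding agrees_iff
  proof (intro allI impI)
    fix x b assume x: "K x = Some b"
    then have "x < n" using d by blast
    show "\<xi> ! x = b"
    proof (cases "x \<in> {j..<j + length w}")
      case True
      then have "x = j + (x - j)" "x - j < length w" by auto
      then have "b = w ! (x - j)" using con x unfolding consistent_def by metis
      then show ?thesis using True \<open>x < n\<close> by (simp add: \<xi>_def)
    next
      case False
      then show ?thesis using x \<zeta>(2) \<open>x < n\<close> unfolding agrees_iff by (auto simp: \<xi>_def)
    qed
  qed
  moreover from this have "agrees K (\<xi>[y := c])"
    unfolding agrees_iff using y'(4) by (metis nth_list_update_neq option.distinct(1))
  moreover have "\<xi> \<in> words n" "\<xi>[y := c] \<in> words n" by (simp_all add: \<xi>_def words_def)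
  ultimately have "mpmp D \<xi> = mpmp D (\<xi>[y := c])" using det unfolding determined_def by blast
  moreover have "(j, w) \<in> mpmp D \<xi>"
    using p by (auto simp: mpmp_def occurs_at_iff \<xi>_def)
  moreover have "(j, w) \<notin> mpmp D (\<xi>[y := c])"
  proof
    assume "(j, w) \<in> mpmp D (\<xi>[y := c])"
    then have "\<forall>i<length w. \<xi>[y := c] ! (j + i) = w ! i" by (simp add: mpmp_def occurs_at_iff)
    moreover have "y - j < length w" using y' by simp
    ultimately have "\<xi>[y := c] ! (j + (y - j)) = w ! (y - j)" by blast
    then show False using y' c by (simp add: \<xi>_def)
  qed
  ultimately show False by simp
qed

text \<open>The first read is always needed. With probability at least 1/s it agrees with
  \<open>w\<close>, and then, as \<open>m \<ge> 2\<close>, a second one is needed.\<close>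

lemma cost_ge_two_reads:
  fixes D :: "'a::finite list set"
  assumes s: "CARD('a) \<ge> 2" and w: "w \<in> D" "length w = m" and m: "m \<ge> 2"
  shows "1 + 1 / real CARD('a) \<le> cost m D Map.empty"
proof -
  let ?s = "real CARD('a)"
  have "\<not> determined m D Map.empty"
    using w m by (intro not_determined_if_unchecked[OF s, where j = 0 and w = w and y = 0])
      (auto simp: consistent_def)
  then obtain x where x: "x \<in> {..<m} - dom (Map.empty :: nat \<rightharpoonup> 'a)"
    and cx: "cost m D Map.empty = 1 + (\<Sum>c\<in>UNIV. cost m D [x \<mapsto> c]) / ?s"
    by (rule cost_attained)
  have nd: "\<not> determined m D [x \<mapsto> w ! x]"
  proof (rule not_determined_if_unchecked[OF s, where j = 0 and w = w and y = "if x = 0 then 1 else 0"])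
    show "consistent [x \<mapsto> w ! x] 0 w" by (auto simp: consistent_def)
  qed (use w m x in auto)
  have "1 \<le> cost m D [x \<mapsto> w ! x]"
  proof -
    obtain y where "cost m D [x \<mapsto> w ! x] = 1 + (\<Sum>c\<in>UNIV. cost m D ([x \<mapsto> w ! x, y \<mapsto> c])) / ?s"
      using cost_attained[OF nd] by metis
    moreover have "0 \<le> (\<Sum>c\<in>UNIV. cost m D ([x \<mapsto> w ! x, y \<mapsto> c])) / ?s"
      by (intro divide_nonneg_nonneg sum_nonneg cost_nonneg) simp
    ultimately show ?thesis by linarith
  qed
  also have "\<dots> \<le> (\<Sum>c\<in>UNIV. cost m D [x \<mapsto> c])"
    by (rule member_le_sum) (auto simp: cost_nonneg)
  finally have "1 / ?s \<le> (\<Sum>c\<in>UNIV. cost m D [x \<mapsto> c]) / ?s" by (rule divide_right_mono) simp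
  then show ?thesis unfolding cx by linarith
qed

text \<open>Greedy choice: a position is skipped only if it equals j + x - y for some chosen j and
  x, y in \<open>C\<close>, so each chosen position accounts for at most
  \<open>(card C)\<^sup>2\<close> positions. The last condition says that the translates C - j are
  pairwise disjoint.\<close>

lemma spread_positions_exist:
  fixes C :: "nat set"
  assumes C: "finite C" "C \<noteq> {}"
  obtains J where "J \<subseteq> {..<b}" "b \<le> card J * (card C)\<^sup>2"
    "\<And>j j' x y. j \<in> J \<Longrightarrow> j' \<in> J \<Longrightarrow> j \<noteq> j' \<Longrightarrow> x \<in> C \<Longrightarrow> y \<in> C \<Longrightarrow> x + j' \<noteq> y + j"
proof -
  let ?cov = "\<lambda>J. (\<lambda>(j, x, y). j + x - y) ` (J \<times> C \<times> C)"
  let ?spread = "\<lambda>J. \<forall>j\<in>J. \<forall>j'\<in>J. j \<noteq> j' \<longrightarrow> (\<forall>x\<in>C. \<forall>y\<in>C. x + j' \<noteq> y + j)"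
  have "\<exists>J \<subseteq> {..<b}. ?spread J \<and> {..<b} \<subseteq> ?cov J"
  proof (induction b)
    case (Suc b)
    then obtain J where J: "J \<subseteq> {..<b}" "?spread J" "{..<b} \<subseteq> ?cov J" by blast
    show ?case
    proof (cases "\<exists>j\<in>J. \<exists>x\<in>C. \<exists>y\<in>C. x + b = y + j")
      case True
      then obtain j x y where *: "j \<in> J" "x \<in> C" "y \<in> C" "x + b = y + j" by blast
      then have "b = j + y - x" by linarith
      then have "b \<in> ?cov J" using * by (intro image_eqI[of _ _ "(j, y, x)"]) auto
      then have "{..<Suc b} \<subseteq> ?cov J" using J(3) by (simp add: lessThan_Suc)
      then show ?thesis using J(1,2) by (intro exI[of _ J]) auto
    next
      case False
      have "?spread (insert b J)" using J(2) False by (metis insert_iff)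
      moreover obtain x where "x \<in> C" using C(2) by blast
      then have "b \<in> ?cov (insert b J)" by (intro image_eqI[of _ _ "(b, x, x)"]) auto
      then have "{..<Suc b} \<subseteq> ?cov (insert b J)" using J(3) unfolding lessThan_Suc by blast
      ultimately show ?thesis using J(1) by (intro exI[of _ "insert b J"]) auto
    qed
  qed simp
  then obtain J where J: "J \<subseteq> {..<b}" "?spread J" "{..<b} \<subseteq> ?cov J" by blast
  have fin: "finite J" using J(1) finite_subset by blast
  have "card {..<b} \<le> card (?cov J)" using J(3) fin C(1) by (intro card_mono) auto
  also have "\<dots> \<le> card (J \<times> C \<times> C)" using fin C(1) by (intro card_image_le) auto
  finally have "b \<le> card J * (card C)\<^sup>2" by (simp add: card_cartesian_product power2_eq_square)
  then show ?thesis using that J(1,2) by blast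
qed

text \<open>
  Overwriting the positions of one block by its pattern maps the words avoiding the other patterns
  to those which in addition match this one, and at most \<open>s\<^sup>l\<close> words have the same image.
\<close>

lemma card_avoiding_words:
  fixes A :: "'j \<Rightarrow> nat set" and pat :: "'j \<Rightarrow> nat \<Rightarrow> 'a::finite"
  assumes "finite J" and "\<And>j. j \<in> J \<Longrightarrow> A j \<subseteq> {..<m}" and "\<And>j. j \<in> J \<Longrightarrow> card (A j) \<le> l"
    and "\<And>j j'. j \<in> J \<Longrightarrow> j' \<in> J \<Longrightarrow> j \<noteq> j' \<Longrightarrow> A j \<inter> A j' = {}"
  shows "real (card {w \<in> words m. \<forall>j\<in>J. \<exists>i\<in>A j. w ! i \<noteq> pat j i})
    \<le> real CARD('a) ^ m * (1 - 1 / real CARD('a) ^ l) ^ card J"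
  using assms
proof (induction J rule: finite_induct)
  case empty
  then show ?case by (simp add: card_words)
next
  case (insert j J)
  let ?s = "real CARD('a)"
  let ?G = "{w \<in> words m. \<forall>j\<in>J. \<exists>i\<in>A j. w ! i \<noteq> pat j i}"
  let ?H = "{w \<in> ?G. \<forall>i\<in>A j. w ! i = pat j i}"
  have s: "?s \<ge> 1" by (simp add: Suc_le_eq)
  have finG: "finite ?G" by simp
  have finA: "finite (A j)" using insert.prems(1)[of j] finite_subset by blast
  define ov where "ov w = map (\<lambda>i. if i \<in> A j then pat j i else w ! i) [0..<m]" for w
  let ?\<Phi> = "\<lambda>w :: 'a list. (ov w, restrict ((!) w) (A j))"
  have inj: "inj_on ?\<Phi> ?G"
  proof (rule inj_onI)
    fix v w assume vw: "v \<in> ?G" "w \<in> ?G" and eq: "?\<Phi> v = ?\<Phi> w"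
    then have l: "length v = m" "length w = m" by (auto simp: words_def)
    show "v = w"
    proof (rule nth_equalityI)
      fix i assume "i < length v"
      then have i: "i < m" using l by simp
      show "v ! i = w ! i"
      proof (cases "i \<in> A j")
        case True
        then show ?thesis using eq by (metis prod.inject restrict_apply')
      next
        case False
        have "ov v ! i = ov w ! i" using eq by simp
        then show ?thesis using False i by (simp add: ov_def)
      qed
    qed (use l in simp)
  qed
  have img: "?\<Phi> ` ?G \<subseteq> ?H \<times> (A j \<rightarrow>\<^sub>E UNIV)"
  proof (rule image_subsetI)
    fix w assume w: "w \<in> ?G"
    have nth: "ov w ! i = (if i \<in> A j then pat j i else w ! i)" if "i < m" for i
      using that by (simp add: ov_def)
    have "\<exists>i\<in>A j'. ov w ! i \<noteq> pat j' i" if j': "j' \<in> J" for j'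
    proof -
      obtain i where i: "i \<in> A j'" "w ! i \<noteq> pat j' i" using w j' by blast
      have "i \<notin> A j" using insert.prems(3)[of j j'] insert.hyps(2) j' i(1) by auto
      moreover have "i < m" using insert.prems(1)[of j'] j' i(1) by auto
      ultimately have "ov w ! i \<noteq> pat j' i" using i(2) nth[of i] by simp
      then show ?thesis using i(1) by blast
    qed
    moreover have "\<forall>i\<in>A j. ov w ! i = pat j i" using nth insert.prems(1)[of j] by auto
    moreover have "ov w \<in> words m" by (simp add: ov_def words_def)
    ultimately show "?\<Phi> w \<in> ?H \<times> (A j \<rightarrow>\<^sub>E UNIV)" by auto
  qed
  have "card ?G \<le> card (?H \<times> (A j \<rightarrow>\<^sub>E (UNIV :: 'a set)))"
    using finG finA by (intro card_inj_on_le[OF inj img]) (auto intro!: finite_cartesian_product finite_PiE)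
  also have "\<dots> = card ?H * CARD('a) ^ card (A j)"
    using finA by (simp add: card_cartesian_product card_PiE)
  also have "\<dots> \<le> card ?H * CARD('a) ^ l"
    using insert.prems(2)[of j] by (intro mult_left_mono power_increasing) (auto simp: Suc_le_eq)
  finally have "real (card ?G) \<le> real (card ?H * CARD('a) ^ l)" by (rule of_nat_mono)
  then have GH: "real (card ?G) / ?s ^ l \<le> real (card ?H)" using s by (simp add: divide_le_eq)
  have HG: "?H \<subseteq> ?G" by blast
  have "{w \<in> words m. \<forall>j\<in>insert j J. \<exists>i\<in>A j. w ! i \<noteq> pat j i} = ?G - ?H" by auto
  then have "real (card {w \<in> words m. \<forall>j\<in>insert j J. \<exists>i\<in>A j. w ! i \<noteq> pat j i})
      = real (card ?G) - real (card ?H)"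
    using card_Diff_subset[OF finite_subset[OF HG finG] HG] card_mono[OF finG HG]
    by (simp only: of_nat_diff)
  also have "\<dots> \<le> real (card ?G) * (1 - 1 / ?s ^ l)" using GH by (simp add: right_diff_distrib)
  also have "\<dots> \<le> (?s ^ m * (1 - 1 / ?s ^ l) ^ card J) * (1 - 1 / ?s ^ l)"
  proof (intro mult_right_mono insert.IH)
    show "0 \<le> 1 - 1 / ?s ^ l" using s by (simp add: one_le_power)
  qed (use insert.prems in auto)
  finally show ?case using insert.hyps by (simp add: mult_ac)
qed

text \<open>The characters of the text on \<open>C\<close> exclude these words at all of the first
  \<open>b\<close> starting places; in the application \<open>b\<close> counts all placements of a
  word of length \<open>m\<close>.\<close>

definition refuted :: "nat \<Rightarrow> nat \<Rightarrow> nat set \<Rightarrow> 'a::finite list \<Rightarrow> 'a list set" where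
  "refuted m b C \<xi> = {w \<in> words m. \<forall>j<b. \<exists>x \<in> C \<inter> {j..<j + m}. w ! (x - j) \<noteq> \<xi> ! x}"

text \<open>Only the starting places in a spread set \<open>J\<close> are used. Their constraints
  concern disjoint blocks \<open>A j\<close> of the word, each of at most \<open>card C\<close>
  letters, so \<open>card_avoiding_words\<close> multiplies the probabilities.\<close>

lemma card_refuted_le:
  fixes \<xi> :: "'a::finite list"
  assumes C: "finite C" "C \<noteq> {}"
  shows "real (card (refuted m b C \<xi>))
    \<le> real CARD('a) ^ m * exp (- (real b / (real (card C) ^ 2 * real CARD('a) ^ card C)))"
proof -
  let ?s = "real CARD('a)" and ?l = "card C"
  obtain J where J: "J \<subseteq> {..<b}" "b \<le> card J * ?l\<^sup>2"
    and spread: "\<And>j j' x y. j \<in> J \<Longrightarrow> j' \<in> J \<Longrightarrow> j \<noteq> j' \<Longrightarrow> x \<in> C \<Longrightarrow> y \<in> C \<Longrightarrow> x + j' \<noteq> y + j"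
    using spread_positions_exist[OF C] by metis
  define A where "A j = (\<lambda>x. x - j) ` (C \<inter> {j..<j + m})" for j
  let ?B = "{w \<in> words m. \<forall>j\<in>J. \<exists>i\<in>A j. w ! i \<noteq> \<xi> ! (j + i)}"
  have finJ: "finite J" using J(1) finite_subset by blast
  have s: "?s \<ge> 1" by (simp add: Suc_le_eq)
  have sub: "refuted m b C \<xi> \<subseteq> ?B"
  proof
    fix w assume w: "w \<in> refuted m b C \<xi>"
    have "\<exists>i\<in>A j. w ! i \<noteq> \<xi> ! (j + i)" if "j \<in> J" for j
    proof -
      obtain x where "x \<in> C \<inter> {j..<j + m}" "w ! (x - j) \<noteq> \<xi> ! x"
        using w \<open>j \<in> J\<close> J(1) unfolding refuted_def by blast
      then show ?thesis unfolding A_def by (intro bexI[of _ "x - j"]) auto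
    qed
    then show "w \<in> ?B" using w by (auto simp: refuted_def)
  qed
  have "real (card (refuted m b C \<xi>)) \<le> real (card ?B)"
    using sub by (intro of_nat_mono card_mono) auto
  also have "\<dots> \<le> ?s ^ m * (1 - 1 / ?s ^ ?l) ^ card J"
  proof (rule card_avoiding_words[OF finJ])
    show "A j \<subseteq> {..<m}" for j by (auto simp: A_def)
    show "card (A j) \<le> ?l" for j
      unfolding A_def using C(1)
      by (meson card_image_le card_mono finite_Int inf_le1 order_trans)
    show "A j \<inter> A j' = {}" if "j \<in> J" "j' \<in> J" "j \<noteq> j'" for j j'
    proof (rule ccontr)
      assume "A j \<inter> A j' \<noteq> {}"
      then obtain x y where "x \<in> C" "y \<in> C" "j \<le> x" "j' \<le> y" "x - j = y - j'"
        unfolding A_def by auto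
      then show False using spread[OF that, of x y] by simp
    qed
  qed
  also have "\<dots> \<le> ?s ^ m * exp (- (real b / (real ?l ^ 2 * ?s ^ ?l)))"
  proof (intro mult_left_mono)
    have "(1 - 1 / ?s ^ ?l) ^ card J \<le> exp (- (1 / ?s ^ ?l)) ^ card J"
      using exp_ge_add_one_self[of "- (1 / ?s ^ ?l)"] s by (intro power_mono) (auto simp: one_le_power)
    also have "\<dots> = exp (- (real (card J) / ?s ^ ?l))" by (simp add: exp_of_nat_mult[symmetric])
    also have "\<dots> \<le> exp (- (real b / (real ?l ^ 2 * ?s ^ ?l)))"
    proof -
      have l: "real ?l ^ 2 > 0" using C by (simp add: card_gt_0_iff)
      have "real b \<le> real (card J * ?l\<^sup>2)" using J(2) by (rule of_nat_mono)
      then have "real b / real ?l ^ 2 \<le> real (card J)" using l by (simp add: divide_le_eq)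
      then have "real b / real ?l ^ 2 / ?s ^ ?l \<le> real (card J) / ?s ^ ?l"
        using s by (intro divide_right_mono) auto
      then show ?thesis by simp
    qed
    finally show "(1 - 1 / ?s ^ ?l) ^ card J \<le> exp (- (real b / (real ?l ^ 2 * ?s ^ ?l)))" .
  qed (use s in simp)
  finally show ?thesis .
qed

text \<open>As \<open>card C < m\<close>, no window of length \<open>m\<close> is read completely,
  so a certificate must show a mismatch in every one of them.\<close>

lemma determined_refuted:
  fixes D :: "'a::finite list set"
  assumes s: "CARD('a) \<ge> 2" and C: "C \<subseteq> {..<n}" "card C < m" and n: "n + 1 = m + b"
    and det: "determined n D (\<lambda>x. if x \<in> C then Some (\<xi> ! x) else None)" (is "determined n D ?K")
  shows "{w \<in> D. length w = m} \<subseteq> refuted m b C \<xi>"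
proof clarify
  fix w assume w: "w \<in> D" "m = length w"
  have "\<exists>x \<in> C \<inter> {j..<j + m}. w ! (x - j) \<noteq> \<xi> ! x" if j: "j < b" for j
  proof (rule ccontr)
    assume a: "\<not> ?thesis"
    have "\<not> {j..<j + m} \<subseteq> C"
    proof
      assume "{j..<j + m} \<subseteq> C"
      then have "card {j..<j + m} \<le> card C" using C(1) finite_subset by (intro card_mono) blast+
      then show False using C(2) by simp
    qed
    then obtain y where y: "y \<in> {j..<j + m} - C" by blast
    have dom: "dom ?K = C" by (auto simp: dom_def)
    have "\<not> determined n D ?K"
    proof (rule not_determined_if_unchecked[OF s _ w(1)])
      show "dom ?K \<subseteq> {..<n}" using C(1) dom by simp
      show "j + length w \<le> n" using j n w(2) by simp
      show "consistent ?K j w"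
        unfolding consistent_def
      proof (intro allI impI)
        fix i c assume i: "i < length w" "?K (j + i) = Some c"
        then have "j + i \<in> C" "c = \<xi> ! (j + i)" by (auto split: if_splits)
        then show "c = w ! i" using a i(1) w(2) by force
      qed
      show "y \<in> {j..<j + length w} - dom ?K" unfolding dom using y w(2) by simp
    qed
    then show False using det by blast
  qed
  then show "w \<in> refuted (length w) b C \<xi>" using w(2) by (simp add: refuted_def words_def)
qed

text \<open>If no set of size \<open>l\<close> refutes all the words, every certificate of the text
  has at least \<open>l + 1\<close> positions; otherwise the summand is at most 0. The summand is
  affine in the indicators, so it can be averaged over dictionaries term by term.\<close>

lemma cost_ge_refutation_count:
  fixes D :: "'a::finite list set"
  assumes s: "CARD('a) \<ge> 2" and l: "l < m" "l \<le> n" and n: "n + 1 = m + b"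
  shows "(\<Sum>\<xi>\<in>words n. (real l + 1) *
      (1 - (\<Sum>C | C \<subseteq> {..<n} \<and> card C = l. of_bool ({w \<in> D. length w = m} \<subseteq> refuted m b C \<xi>))))
    \<le> real CARD('a) ^ n * cost n D Map.empty"
proof (rule certificate_le_cost)
  fix \<xi> :: "'a list" and C
  assume \<xi>: "\<xi> \<in> words n" and C: "C \<subseteq> {..<n}"
    and det: "determined n D (\<lambda>x. if x \<in> C then Some (\<xi> ! x) else None)"
  let ?Cs = "{C. C \<subseteq> {..<n} \<and> card C = l}"
  let ?N = "\<Sum>C\<in>?Cs. of_bool ({w \<in> D. length w = m} \<subseteq> refuted m b C \<xi>) :: real"
  have fin: "finite ?Cs" by simp
  show "(real l + 1) * (1 - ?N) \<le> real (card C)"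
  proof (cases "card C \<le> l")
    case True
    \<comment> \<open>A smaller certificate is padded to size exactly \<open>l\<close>, the only
      size over which the sum runs.\<close>
    then obtain C' where C': "C \<subseteq> C'" "C' \<subseteq> {..<n}" "card C' = l"
      using exists_subset_between[of C l "{..<n}"] C l(2) by auto
    have "agrees (\<lambda>x. if x \<in> C then Some (\<xi> ! x) else None) \<eta>"
      if "agrees (\<lambda>x. if x \<in> C' then Some (\<xi> ! x) else None) \<eta>" for \<eta>
      using that C'(1) unfolding agrees_iff by (auto split: if_splits)
    then have "determined n D (\<lambda>x. if x \<in> C' then Some (\<xi> ! x) else None)"
      using det unfolding determined_def by blast
    then have "{w \<in> D. length w = m} \<subseteq> refuted m b C' \<xi>"
      using determined_refuted[OF s C'(2) _ n] C'(3) l(1) by simp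
    then have "1 \<le> ?N"
      using member_le_sum[of C' ?Cs "\<lambda>C. of_bool ({w \<in> D. length w = m} \<subseteq> refuted m b C \<xi>) :: real"]
        C'(2,3) fin by simp
    then have "(real l + 1) * (1 - ?N) \<le> 0" by (intro mult_nonneg_nonpos) auto
    then show ?thesis by linarith
  next
    case False
    have "0 \<le> ?N" by (intro sum_nonneg) auto
    then have "(real l + 1) * (1 - ?N) \<le> real l + 1" by (simp add: mult_left_le)
    then show ?thesis using False by linarith
  qed
qed

section \<open>Averaging over random dictionaries\<close>

lemma prob_random_words_in:
  fixes G :: "'a::finite list set"
  assumes G: "G \<subseteq> words m"
  shows "measure (random_words r) {\<omega> \<in> space (random_words r). \<forall>i<r m. \<omega> (m, i) \<in> G}
      = (real (card G) / real CARD('a) ^ m) ^ r m" (is ?P)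
    and "{\<omega> \<in> space (random_words r). \<forall>i<r m. \<omega> (m, i) \<in> G} \<in> sets (random_words r)" (is ?S)
proof -
  let ?U = "\<lambda>(m, i :: nat). uniform_count_measure (words m :: 'a list set)"
  let ?J = "{m} \<times> {..<r m}"
  have J: "?J \<subseteq> slots r" "finite ?J" by (auto simp: slots_def)
  have eq: "{\<omega> \<in> space (random_words r). \<forall>i<r m. \<omega> (m, i) \<in> G}
      = prod_emb (slots r) ?U ?J (\<Pi>\<^sub>E x\<in>?J. G)"
    unfolding random_words_def by (auto simp: prod_emb_def space_PiM PiE_iff extensional_def)
  have sG: "G \<in> sets (?U x)" if "x \<in> ?J" for x
    using that G by (auto simp: sets_uniform_count_measure)
  have "measure (Pi\<^sub>M (slots r) ?U) (prod_emb (slots r) ?U ?J (\<Pi>\<^sub>E x\<in>?J. G))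
      = (\<Prod>x\<in>?J. measure (?U x) G)"
    using J sG by (rule word_measures.measure_PiM_emb)
  also have "\<dots> = (\<Prod>x\<in>?J. real (card G) / real CARD('a) ^ m)"
    using G by (intro prod.cong) (auto simp: measure_uniform_count_measure card_words)
  also have "\<dots> = (real (card G) / real CARD('a) ^ m) ^ r m" by (simp add: card_cartesian_product)
  finally show ?P unfolding eq unfolding random_words_def .
  show ?S unfolding eq unfolding random_words_def
    using J sG by (intro sets_PiM_I) auto
qed

lemma Phi_aver_ge_first_reads:
  assumes s: "CARD('a::finite) \<ge> 2" and m: "m \<ge> 2" "r m \<ge> 1"
  shows "ln (real CARD('a)) * ((1 + 1 / real CARD('a)) / real m) \<le> Phi_aver TYPE('a) r"
proof -
  let ?M = "random_words r :: (nat \<times> nat \<Rightarrow> 'a list) measure"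
  let ?B = "ln (real CARD('a)) * ((1 + 1 / real CARD('a)) / real m)"
  interpret prob_space ?M by (rule prob_space_random_words)
  have "?B \<le> Phi (\<omega> ` slots r)" if \<omega>: "\<omega> \<in> space ?M" for \<omega>
  proof -
    have "\<omega> (m, 0) \<in> \<omega> ` slots r" using m by (auto simp: slots_def)
    then have "1 + 1 / real CARD('a) \<le> cost m (\<omega> ` slots r) Map.empty"
      using length_random_word[OF \<omega>, of 0 m] m by (intro cost_ge_two_reads[OF s]) auto
    then have "?B \<le> ln (real CARD('a)) * (cost m (\<omega> ` slots r) Map.empty / real m)"
      by (intro mult_left_mono divide_right_mono) auto
    also have "\<dots> \<le> Phi (\<omega> ` slots r)" using m by (intro Phi_ge_cost) simp
    finally show ?thesis .
  qed
  then have "(\<integral>\<omega>. ?B \<partial>?M) \<le> (\<integral>\<omega>. Phi (\<omega> ` slots r) \<partial>?M)"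
    by (intro integral_mono Phi_integrable) auto
  then show ?thesis unfolding Phi_aver_def by (simp add: prob_space)
qed

lemma Phi_aver_ge_union_bound:
  assumes s: "CARD('a::finite) \<ge> 2" and l: "l > 0" "l < m" "l \<le> n" and n: "n + 1 = m + b"
  shows "ln (real CARD('a)) * ((real l + 1) / real n *
      (1 - real n ^ l * exp (- (real (r m) * real b / (real l ^ 2 * real CARD('a) ^ l)))))
    \<le> Phi_aver TYPE('a) r"
proof -
  let ?M = "random_words r :: (nat \<times> nat \<Rightarrow> 'a list) measure"
  let ?s = "real CARD('a)"
  let ?Cs = "{C. C \<subseteq> {..<n} \<and> card C = l}"
  let ?W = "words n :: 'a list set"
  let ?p = "exp (- (real (r m) * real b / (real l ^ 2 * ?s ^ l)))"
  define A where "A C \<xi> = {\<omega> \<in> space ?M. \<forall>i<r m. \<omega> (m, i) \<in> refuted m b C \<xi>}" for C \<xi>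
  \<comment> \<open>Normalisation: it turns a sum over all texts of length \<open>n\<close> into
    \<open>ln s\<close> times the mean per character.\<close>
  define k where "k = ln ?s / (real n * ?s ^ n)"
  interpret prob_space ?M by (rule prob_space_random_words)
  have n0: "n > 0" using l by simp
  have s0: "?s > 1" using s by simp
  have k0: "k \<ge> 0" using s0 by (simp add: k_def)
  have sub: "refuted m b C \<xi> \<subseteq> words m" for C and \<xi> :: "'a list" by (auto simp: refuted_def)
  have setA: "A C \<xi> \<in> sets ?M" for C \<xi>
    unfolding A_def by (rule prob_random_words_in(2)[OF sub])
  have probA: "prob (A C \<xi>) \<le> ?p" if "C \<in> ?Cs" for C \<xi>
  proof -
    have C: "finite C" "C \<noteq> {}" "card C = l" using that l(1) finite_subset[of C "{..<n}"] by auto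
    have "real (card (refuted m b C \<xi>)) / ?s ^ m \<le> exp (- (real b / (real l ^ 2 * ?s ^ l)))"
      using card_refuted_le[OF C(1,2), of m b \<xi>] C(3) s0 by (simp add: divide_le_eq mult.commute)
    then have "(real (card (refuted m b C \<xi>)) / ?s ^ m) ^ r m
        \<le> exp (- (real b / (real l ^ 2 * ?s ^ l))) ^ r m"
      using s0 by (intro power_mono) auto
    also have "\<dots> = ?p" by (simp add: exp_of_nat_mult[symmetric])
    finally show ?thesis unfolding A_def prob_random_words_in(1)[OF sub] .
  qed
  have cardCs: "real (card ?Cs) \<le> real n ^ l"
  proof -
    have "card ?Cs = n choose l" by (simp add: n_subsets)
    also have "\<dots> \<le> n ^ l" using l(3) by (rule binomial_le_pow)
    finally show ?thesis by (metis of_nat_le_iff of_nat_power)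
  qed
  let ?F = "\<lambda>\<omega>. k * (\<Sum>\<xi>\<in>?W. (real l + 1) * (1 - (\<Sum>C\<in>?Cs. indicator (A C \<xi>) \<omega>)))"
  have le: "?F \<omega> \<le> Phi (\<omega> ` slots r)" if \<omega>: "\<omega> \<in> space ?M" for \<omega>
  proof -
    have "{w \<in> \<omega> ` slots r. length w = m} = (\<lambda>i. \<omega> (m, i)) ` {..<r m}"
      using length_random_word[OF \<omega>] by (auto simp: slots_def)
    then have "indicator (A C \<xi>) \<omega>
        = (of_bool ({w \<in> \<omega> ` slots r. length w = m} \<subseteq> refuted m b C \<xi>) :: real)" for C \<xi>
      using \<omega> by (auto simp: A_def indicator_def)
    then have "?F \<omega> \<le> k * (?s ^ n * cost n (\<omega> ` slots r) Map.empty)"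
      using cost_ge_refutation_count[OF s l(2,3) n, of "\<omega> ` slots r"] k0
      by (intro mult_left_mono) auto
    also have "\<dots> = ln ?s * (cost n (\<omega> ` slots r) Map.empty / real n)"
      using s0 by (simp add: k_def)
    also have "\<dots> \<le> Phi (\<omega> ` slots r)" using n0 by (rule Phi_ge_cost)
    finally show ?thesis .
  qed
  have int: "integrable ?M (indicator (A C \<xi>) :: _ \<Rightarrow> real)" for C \<xi>
    using setA by (intro integrable_real_indicator) (auto simp: emeasure_eq_measure)
  have "ln ?s * ((real l + 1) / real n * (1 - real n ^ l * ?p))
      = k * (\<Sum>\<xi>\<in>?W. (real l + 1) * (1 - real n ^ l * ?p))"
    using s0 n0 by (simp add: k_def card_words)
  also have "\<dots> \<le> k * (\<Sum>\<xi>\<in>?W. (real l + 1) * (1 - (\<Sum>C\<in>?Cs. prob (A C \<xi>))))"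
  proof -
    have "(\<Sum>C\<in>?Cs. prob (A C \<xi>)) \<le> real n ^ l * ?p" for \<xi>
    proof -
      have "(\<Sum>C\<in>?Cs. prob (A C \<xi>)) \<le> (\<Sum>C\<in>?Cs. ?p)" by (intro sum_mono probA)
      also have "\<dots> \<le> real n ^ l * ?p" using cardCs by (simp add: mult_right_mono)
      finally show ?thesis .
    qed
    then show ?thesis using k0 by (intro mult_left_mono sum_mono) auto
  qed
  also have "\<dots> = (\<integral>\<omega>. ?F \<omega> \<partial>?M)"
    using int setA by (simp add: prob_space)
  also have "\<dots> \<le> (\<integral>\<omega>. Phi (\<omega> ` slots r) \<partial>?M)"
    using int le by (intro integral_mono Phi_integrable) auto
  finally show ?thesis unfolding Phi_aver_def .
qed

section \<open>Numerical estimates and the main theorem\<close>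

lemma exp_one_ge: "27 / 10 \<le> exp (1 :: real)"
proof -
  have "(1 + 1 / 8 + (1 / 8)\<^sup>2 / 2 :: real) ^ 8 \<le> exp (1 / 8) ^ 8"
    by (intro power_mono exp_lower_Taylor_quadratic) auto
  also have "\<dots> = exp 1" by (simp add: exp_of_nat_mult[symmetric])
  finally show ?thesis by (simp add: power2_eq_square eval_nat_numeral)
qed

text \<open>The optimal constant is 2/e, attained at x = e^2; 20/27 is the rational bound for it
  obtained from \<open>exp_one_ge\<close>.\<close>

lemma ln_le_sqrt: "x > 0 \<Longrightarrow> ln x \<le> 20 / 27 * sqrt x"
proof -
  assume x: "x > 0"
  define y where "y = sqrt x"
  have y: "y > 0" "x = y ^ 2" using x by (auto simp: y_def)
  have "y / exp 1 \<le> exp (y / exp 1 - 1)" using exp_ge_add_one_self[of "y / exp 1 - 1"] by simp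
  also have "\<dots> = exp (y / exp 1) / exp 1" by (simp add: exp_diff)
  finally have "y \<le> exp (y / exp 1)" by (simp add: divide_le_cancel)
  then have "ln y \<le> y / exp 1" using y by (metis ln_exp ln_le_cancel_iff exp_gt_zero)
  also have "\<dots> \<le> y / (27 / 10)" using exp_one_ge y by (intro divide_left_mono) auto
  finally show ?thesis using y by (simp add: ln_realpow flip: y_def)
qed

text \<open>Applying e z \<le> e^z to z = c \<Lambda> / 7 gives e^(c \<Lambda>) \<ge> (27 c
  \<Lambda> / 70)^7. Four powers of \<Lambda> match the left side and the other three are evaluated
  at the lower bound \<open>\<Lambda>\<^sub>0\<close>. The exponent 7 suits the applications, where
  \<open>c * \<Lambda>\<^sub>0\<close> is close to 7.\<close>

lemma exp_ge_quartic:
  fixes c \<Lambda> \<Lambda>\<^sub>0 P Q :: real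
  assumes c: "c > 0" and \<Lambda>: "\<Lambda>\<^sub>0 > 0" "\<Lambda>\<^sub>0 \<le> \<Lambda>" and PQ: "0 \<le> P" "0 \<le> Q"
    and base: "P * (Q + 9 / 5 / \<Lambda>\<^sub>0\<^sup>2) \<le> (27 * c / 70) ^ 7 * \<Lambda>\<^sub>0 ^ 3"
  shows "P * \<Lambda>\<^sup>2 * (Q * \<Lambda>\<^sup>2 + 9 / 5) \<le> exp (c * \<Lambda>)"
proof -
  have "\<Lambda>\<^sub>0\<^sup>2 \<le> \<Lambda>\<^sup>2" using \<Lambda> by (intro power_mono) auto
  then have "1 \<le> \<Lambda>\<^sup>2 / \<Lambda>\<^sub>0\<^sup>2" using \<Lambda> by simp
  then have "P * \<Lambda>\<^sup>2 * (Q * \<Lambda>\<^sup>2 + 9 / 5) \<le> P * \<Lambda>\<^sup>2 * (Q * \<Lambda>\<^sup>2 + 9 / 5 * (\<Lambda>\<^sup>2 / \<Lambda>\<^sub>0\<^sup>2))"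
    using PQ by (intro mult_left_mono) auto
  also have "\<dots> = P * (Q + 9 / 5 / \<Lambda>\<^sub>0\<^sup>2) * \<Lambda> ^ 4" by (simp add: algebra_simps eval_nat_numeral)
  also have "\<dots> \<le> (27 * c / 70) ^ 7 * \<Lambda>\<^sub>0 ^ 3 * \<Lambda> ^ 4" using base by (intro mult_right_mono) auto
  also have "\<dots> \<le> (27 * c / 70) ^ 7 * \<Lambda> ^ 3 * \<Lambda> ^ 4"
    using c \<Lambda> by (intro mult_right_mono mult_left_mono power_mono) auto
  also have "\<dots> = (27 / 10 * (c * \<Lambda> / 7)) ^ 7" by (simp add: power_mult_distrib power_divide eval_nat_numeral)
  also have "\<dots> \<le> exp (c * \<Lambda> / 7) ^ 7"
  proof (intro power_mono)
    have "27 / 10 * (c * \<Lambda> / 7) \<le> exp 1 * (c * \<Lambda> / 7)"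
      using c \<Lambda> exp_one_ge by (intro mult_right_mono) auto
    also have "\<dots> \<le> exp 1 * exp (c * \<Lambda> / 7 - 1)"
      using exp_ge_add_one_self[of "c * \<Lambda> / 7 - 1"] by (intro mult_left_mono) auto
    also have "\<dots> = exp (c * \<Lambda> / 7)" by (simp add: exp_diff)
    finally show "27 / 10 * (c * \<Lambda> / 7) \<le> exp (c * \<Lambda> / 7)" .
  qed (use c \<Lambda> in auto)
  also have "\<dots> = exp (c * \<Lambda>)" by (simp add: exp_of_nat_mult[symmetric])
  finally show ?thesis .
qed

text \<open>
  The factor in parentheses absorbs the term \<open>1 / (2 s m\<^sub>m\<^sub>i\<^sub>n)\<close> of the theorem, which is at
  most \<open>\<phi> / (2 s ln (2 s))\<close>.
\<close>

definition rate_const :: "nat \<Rightarrow> real" where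
  "rate_const s = (1 + 1 / (2 * real s * ln (2 * real s))) / (5 * sqrt (real s))"

text \<open>The second claim keeps the certificate size below the word length; the third is the
  inequality needed to beat the union bound. The case s = 2 is separate: with E \<le> 19/16 the
  general estimate of ln s would only give 19/60 instead of 3/10.\<close>

lemma rate_const_estimates:
  fixes \<Lambda> :: real and s :: nat
  defines "A \<equiv> rate_const s"
  assumes s: "s \<ge> 2"
  shows "0 < A" and "9 / 5 * A * ln (real s) \<le> 3 / 10"
    and "1 + 1 / real s < A * \<Lambda> \<Longrightarrow>
      2 * real s * (9 / 5 * A * \<Lambda>)\<^sup>2 * (9 / 5 * A * \<Lambda>\<^sup>2 + 9 / 5)
        \<le> exp ((1 - 9 / 5 * A * ln (real s)) * \<Lambda>)"
proof -
  define E where "E = 1 + 1 / (2 * real s * ln (2 * real s))"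
  have s0: "real s \<ge> 2" "sqrt (real s) > 0" using s by auto
  have ln2s: "ln (2 * real s) > 0" using s by simp
  have E1: "E > 1" using ln2s s0 by (simp add: E_def)
  have A: "A = E / (5 * sqrt (real s))" by (simp add: A_def rate_const_def E_def)
  show A0: "0 < A" using E1 s0 by (simp add: A)
  \<comment> \<open>Numerical interface: \<open>1 - c\<close> bounds the fraction of \<Lambda> lost
    to \<open>s ^ l\<close>, \<open>P\<close> and \<open>Q\<close> bound the prefactors, and
    \<open>\<Lambda>\<^sub>0\<close> is a lower bound for \<Lambda> forced by the premise. One
    inequality between these numbers then suffices.\<close>
  have core: "9 / 5 * A * ln (real s) \<le> 3 / 10 \<and> (1 + 1 / real s < A * \<Lambda> \<longrightarrow>
      2 * real s * (9 / 5 * A * \<Lambda>)\<^sup>2 * (9 / 5 * A * \<Lambda>\<^sup>2 + 9 / 5)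
        \<le> exp ((1 - 9 / 5 * A * ln (real s)) * \<Lambda>))"
    if "9 / 5 * A * ln (real s) \<le> 1 - c" "c \<ge> 7 / 10" "9 / 5 * A \<le> Q" "2 * (9 / 25 * E)\<^sup>2 \<le> P"
      "1 + 1 / real s < A * \<Lambda> \<Longrightarrow> \<Lambda>\<^sub>0 \<le> \<Lambda>" "\<Lambda>\<^sub>0 > 0"
      "P * (Q + 9 / 5 / \<Lambda>\<^sub>0\<^sup>2) \<le> (27 * c / 70) ^ 7 * \<Lambda>\<^sub>0 ^ 3" for c P Q \<Lambda>\<^sub>0
  proof (intro conjI impI)
    show "9 / 5 * A * ln (real s) \<le> 3 / 10" using that(1,2) by simp
    assume "1 + 1 / real s < A * \<Lambda>"
    then have \<Lambda>: "\<Lambda>\<^sub>0 \<le> \<Lambda>" by (rule that(5))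
    have P0: "0 \<le> P" using that(4) zero_le_power2[of "9 / 25 * E"] by linarith
    have Q0: "0 \<le> Q" using that(3) A0 by linarith
    \<comment> \<open>The square root in \<open>rate_const\<close> cancels the factor
      \<open>s\<close> here, so the prefactor is bounded uniformly in \<open>s\<close>.\<close>
    have "(sqrt (real s))\<^sup>2 = real s" by simp
    then have "2 * real s * (9 / 5 * A * \<Lambda>)\<^sup>2 = 2 * (9 / 25 * E)\<^sup>2 * \<Lambda>\<^sup>2"
      using s0 unfolding A by (simp add: power_mult_distrib power_divide)
    also have "\<dots> \<le> P * \<Lambda>\<^sup>2" using that(4) by (intro mult_right_mono) auto
    finally have "2 * real s * (9 / 5 * A * \<Lambda>)\<^sup>2 * (9 / 5 * A * \<Lambda>\<^sup>2 + 9 / 5)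
        \<le> P * \<Lambda>\<^sup>2 * (9 / 5 * A * \<Lambda>\<^sup>2 + 9 / 5)"
      using A0 by (intro mult_right_mono) auto
    also have "\<dots> \<le> P * \<Lambda>\<^sup>2 * (Q * \<Lambda>\<^sup>2 + 9 / 5)"
      using that(3) P0 by (intro mult_left_mono add_right_mono mult_right_mono) auto
    also have "\<dots> \<le> exp (c * \<Lambda>)"
      using that(2,6,7) \<Lambda> P0 Q0 by (intro exp_ge_quartic) auto
    also have "\<dots> \<le> exp ((1 - 9 / 5 * A * ln (real s)) * \<Lambda>)"
    proof -
      have "c * \<Lambda> \<le> (1 - 9 / 5 * A * ln (real s)) * \<Lambda>"
        using that(1,6) \<Lambda> by (intro mult_right_mono) auto
      then show ?thesis by simp
    qed
    finally show "2 * real s * (9 / 5 * A * \<Lambda>)\<^sup>2 * (9 / 5 * A * \<Lambda>\<^sup>2 + 9 / 5)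
        \<le> exp ((1 - 9 / 5 * A * ln (real s)) * \<Lambda>)" .
  qed
  have "9 / 5 * A * ln (real s) \<le> 3 / 10 \<and> (1 + 1 / real s < A * \<Lambda> \<longrightarrow>
      2 * real s * (9 / 5 * A * \<Lambda>)\<^sup>2 * (9 / 5 * A * \<Lambda>\<^sup>2 + 9 / 5)
        \<le> exp ((1 - 9 / 5 * A * ln (real s)) * \<Lambda>))"
  proof (cases "s = 2")
    case True
    have "ln (2 * real s) = 2 * ln 2" using True ln_realpow[of 2 2] by simp
    then have "16 / 3 \<le> 2 * real s * ln (2 * real s)" using True ln2_ge_two_thirds by simp
    then have "1 / (2 * real s * ln (2 * real s)) \<le> 1 / (16 / 3)" by (intro divide_left_mono) auto
    then have E: "E \<le> 19 / 16" unfolding E_def by simp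
    have "1414 / 1000 \<le> sqrt (real s)"
      using True by (intro real_le_rsqrt) (simp add: power2_eq_square)
    then have "A \<le> (19 / 16) / (5 * (1414 / 1000))" unfolding A using E E1 by (intro frac_le) auto
    then have A168: "A \<le> 168 / 1000" by simp
    have "A * ln (real s) \<le> 168 / 1000 * (25 / 36)"
      using A168 A0 True ln2_le_25_over_36 by (intro mult_mono) auto
    moreover have "(9 / 25 * E)\<^sup>2 \<le> (9 / 25 * (19 / 16))\<^sup>2" using E E1 by (intro power_mono) auto
    moreover have "89 / 10 \<le> \<Lambda>" if "1 + 1 / real s < A * \<Lambda>"
    proof (rule ccontr)
      assume "\<not> 89 / 10 \<le> \<Lambda>"
      then have "A * \<Lambda> \<le> A * (89 / 10)" using A0 by (intro mult_left_mono) auto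
      then show False using that True A168 by simp
    qed
    \<comment> \<open>With A \<le> 0.168: 79/100 is 1 - 9/5 * 0.168 * 25/36, 0.3024 is 9/5 * 0.168,
      0.366 rounds up 2 (9/25 * 19/16)^2, and 8.9 rounds down 1.5 / 0.168.\<close>
    ultimately show ?thesis using A168
      by (intro core[of "79 / 100" "3024 / 10000" "366 / 1000" "89 / 10"])
        (auto simp: power2_eq_square eval_nat_numeral)
  next
    case False
    then have s3: "real s \<ge> 3" using s by simp
    have "1 \<le> ln (3::real)" using exp_le by (simp add: ln_ge_iff)
    then have "5 / 3 \<le> ln (2 * 3 :: real)" using ln2_ge_two_thirds by (subst ln_mult) auto
    also have "\<dots> \<le> ln (2 * real s)" using s3 by (intro ln_mono) auto
    finally have "6 * (5 / 3) \<le> 2 * real s * ln (2 * real s)" using s3 by (intro mult_mono) auto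
    then have "1 / (2 * real s * ln (2 * real s)) \<le> 1 / 10" by (intro divide_left_mono) auto
    then have E: "E \<le> 11 / 10" unfolding E_def by simp
    have "1732 / 1000 \<le> sqrt (real s)"
      using s3 by (intro real_le_rsqrt) (simp add: power2_eq_square)
    then have "A \<le> (11 / 10) / (5 * (1732 / 1000))" unfolding A using E E1 by (intro frac_le) auto
    then have A127: "9 / 5 * A \<le> 2288 / 10000" by simp
    have "A * ln (real s) \<le> A * (20 / 27 * sqrt (real s))"
      using ln_le_sqrt[of "real s"] s3 A0 by (intro mult_left_mono) auto
    also have "\<dots> = 4 / 27 * E" using s0 by (simp add: A)
    finally have "9 / 5 * A * ln (real s) \<le> 1 - 706 / 1000" using E by simp
    moreover have "(9 / 25 * E)\<^sup>2 \<le> (9 / 25 * (11 / 10))\<^sup>2" using E E1 by (intro power_mono) auto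
    moreover have "104 / 10 \<le> \<Lambda>" if "1 + 1 / real s < A * \<Lambda>"
    proof (rule ccontr)
      assume "\<not> 104 / 10 \<le> \<Lambda>"
      then have "A * \<Lambda> \<le> A * (104 / 10)" using A0 by (intro mult_left_mono) auto
      also have "\<dots> \<le> (11 / 10) / (5 * sqrt (real s)) * (104 / 10)"
        unfolding A using E s0 by (intro mult_right_mono divide_right_mono) auto
      finally have "A * \<Lambda> \<le> 2288 / 1000 / sqrt (real s)" by simp
      with that have "1 + 1 / real s < 2288 / 1000 / sqrt (real s)" by linarith
      then have "(1 + 1 / real s)\<^sup>2 < (2288 / 1000 / sqrt (real s))\<^sup>2"
        using s0 by (intro power_strict_mono) auto
      then have "(1 + 1 / real s)\<^sup>2 < (2288 / 1000)\<^sup>2 / real s" by (simp add: power_divide)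
      then have "(1 + 1 / real s)\<^sup>2 * real s < (2288 / 1000)\<^sup>2" using s0 by (simp add: less_divide_eq)
      moreover have "(1 + 1 / real s)\<^sup>2 * real s = real s + 2 + 1 / real s"
        using s0 by (simp add: power2_eq_square field_simps)
      \<comment> \<open>For s \<ge> 3 the sum s + 2 + 1/s is smallest at s = 3, and 5 + 1/3 exceeds
        2.288^2.\<close>
      moreover have "5 + 1 / 3 \<le> real s + 2 + 1 / real s"
      proof -
        have "0 \<le> (real s - 3) * (3 * real s - 1) / (3 * real s)"
          using s3 by (intro divide_nonneg_nonneg mult_nonneg_nonneg) auto
        also have "\<dots> = (real s + 2 + 1 / real s) - (5 + 1 / 3)" using s0 by (simp add: field_simps)
        finally show ?thesis by simp
      qed
      ultimately show False by (simp add: power2_eq_square)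
    qed
    ultimately show ?thesis using A127
      by (intro core[of "706 / 1000" "2288 / 10000" "3137 / 10000" "104 / 10"])
        (auto simp: power2_eq_square eval_nat_numeral)
  qed
  then show "9 / 5 * A * ln (real s) \<le> 3 / 10" and "1 + 1 / real s < A * \<Lambda> \<Longrightarrow>
      2 * real s * (9 / 5 * A * \<Lambda>)\<^sup>2 * (9 / 5 * A * \<Lambda>\<^sup>2 + 9 / 5)
        \<le> exp ((1 - 9 / 5 * A * ln (real s)) * \<Lambda>)" by blast+
qed

text \<open>This is the origin of the summand 9/5 in the exponent estimates, which buys the failure
  probability 1/6; the factor 9/5 in front of A is the oversized certificate and a separate
  choice.\<close>

lemma ln_six_le: "ln 6 \<le> (9 / 5 :: real)"
proof -
  have "(6 :: real) \<le> (1 + 9 / 80 + (9 / 80)\<^sup>2 / 2) ^ 16" by (simp add: power2_eq_square eval_nat_numeral)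
  also have "\<dots> \<le> exp (9 / 80) ^ 16" by (intro power_mono exp_lower_Taylor_quadratic) auto
  also have "\<dots> = exp (9 / 5)" by (simp add: exp_of_nat_mult[symmetric])
  finally have "ln 6 \<le> ln (exp (9 / 5 :: real))" by (intro ln_mono) auto
  then show ?thesis by simp
qed

text \<open>
  A certificate size of about \<open>9/5 A \<Lambda>\<close> on texts of length \<open>3/2 m\<close>: failing with probability at
  most \<open>1/6\<close>, it gives \<open>9/5 \<cdot> 5/6 / (3/2) = 1\<close> times the wanted rate \<open>A \<Lambda> / m\<close>.
\<close>

lemma certificate_parameters_exist:
  fixes s m R :: nat
  defines "\<Lambda> \<equiv> ln (real s * real m * real R)" and "A \<equiv> rate_const s"
  assumes s: "s \<ge> 2" and m: "m \<ge> 2" and R: "1 \<le> R" "R \<le> s ^ m" and big: "1 + 1 / real s < A * \<Lambda>"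
  obtains l b n :: nat where "0 < l" "l < m" "l \<le> n" "n + 1 = m + b"
    "A * \<Lambda> / real m \<le> (real l + 1) / real n *
      (1 - real n ^ l * exp (- (real R * real b / (real l ^ 2 * real s ^ l))))"
proof -
  define x where "x = 9 / 5 * A * \<Lambda>"
  \<comment> \<open>The largest integer strictly below \<open>x\<close>: \<open>l < x\<close> serves
    the probability bound, while \<open>x \<le> l + 1\<close> is what the number of reads gives
    back.\<close>
  define l where "l = nat (\<lceil>x\<rceil> - 1)"
  \<comment> \<open>Half of \<open>m\<close>, rounded up, so that b \<ge> m/2 and still n = m + b -
    1 \<le> 3m/2.\<close>
  define b where "b = (m + 1) div 2"
  define n where "n = m + b - 1"
  note est = rate_const_estimates[OF s, folded A_def]
  have s0: "real s > 1" "ln (real s) > 0" using s by auto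
  have "0 \<le> 1 / real s" by simp
  with big have A\<Lambda>: "A * \<Lambda> > 1" by linarith
  have "x = 9 / 5 * (A * \<Lambda>)" by (simp add: x_def)
  with A\<Lambda> have x1: "x > 1" by linarith
  then have ceil: "\<lceil>x\<rceil> \<ge> 2" by linarith
  have rl: "real l = of_int \<lceil>x\<rceil> - 1" using ceil by (simp add: l_def of_nat_nat)
  have lx: "real l < x" "x \<le> real l + 1" unfolding rl by linarith+
  have l0: "l > 0" using ceil by (simp add: l_def)
  have "m \<le> 2 * b" "2 * b \<le> m + 1" "1 \<le> b" using m unfolding b_def by linarith+
  then have "b \<ge> 1" "real m \<le> real (2 * b)" "real (2 * b) \<le> real (m + 1)"
    unfolding of_nat_le_iff by blast+
  then have b: "b \<ge> 1" "real m / 2 \<le> real b" "2 * real b \<le> real m + 1" by simp_all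
  have n: "n + 1 = m + b" using m by (simp add: n_def)
  then have "real n + 1 = real m + real b" by (metis of_nat_1 of_nat_add)
  then have "2 * real n \<le> 3 * real m" "real n \<ge> real m" using b m by linarith+
  then have n32: "real n \<le> 3 / 2 * real m" "real n \<ge> real m" by simp_all
  have Y0: "real s * real m * real R > 0" using s m R by simp
  have "A * \<Lambda> > 0" using A\<Lambda> by linarith
  then have \<Lambda>0: "\<Lambda> > 0" using est(1) by (simp add: zero_less_mult_iff)
  \<comment> \<open>The crude bound m \<le> s^(m-1) gives s m R \<le> s^(2m). Hence x \<le> 2m *
    3/10, which puts \<open>l\<close> below \<open>m\<close>.\<close>
  have \<Lambda>m: "\<Lambda> \<le> 2 * real m * ln (real s)"
  proof -
    have "m \<le> s ^ (m - 1)"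
    proof -
      have "m - 1 < 2 ^ (m - 1)" by (rule less_exp)
      then have "m \<le> 2 ^ (m - 1)" by linarith
      also have "\<dots> \<le> s ^ (m - 1)" using s by (intro power_mono) auto
      finally show ?thesis .
    qed
    then have "s * m * R \<le> s * s ^ (m - 1) * s ^ m" using R by (intro mult_mono) auto
    also have "s * s ^ (m - 1) = s ^ m" using m by (simp flip: power_Suc)
    finally have "real (s * m * R) \<le> real (s ^ m * s ^ m)" by (rule of_nat_mono)
    then have "\<Lambda> \<le> ln (real s ^ m * real s ^ m)" unfolding \<Lambda>_def using Y0 by (intro ln_mono) auto
    also have "\<dots> = 2 * real m * ln (real s)" using s0 by (simp add: ln_mult ln_realpow)
    finally show ?thesis .
  qed
  have "x \<le> 9 / 5 * A * (2 * real m * ln (real s))"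
    unfolding x_def using \<Lambda>m est(1) by (intro mult_left_mono) auto
  also have "\<dots> = (9 / 5 * A * ln (real s)) * (2 * real m)" by simp
  also have "\<dots> \<le> 3 / 10 * (2 * real m)" using est(2) by (intro mult_right_mono) auto
  finally have "real l < real m" using lx(1) m by linarith
  then have lm: "l < m" by simp
  then have ln: "l \<le> n" using n b by linarith
  have x2: "0 < 2 * x\<^sup>2" using x1 by simp
  define X where "X = real R * real b / (real l ^ 2 * real s ^ l)"
  have sl: "real s ^ l \<le> exp (9 / 5 * A * ln (real s) * \<Lambda>)"
  proof -
    have "real s ^ l = exp (real l * ln (real s))" using s0 by (simp add: exp_of_nat_mult)
    also have "\<dots> \<le> exp (x * ln (real s))" using lx s0 by simp
    finally show ?thesis by (simp add: x_def mult_ac)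
  qed
  have "2 * real s * x\<^sup>2 * (9 / 5 * A * \<Lambda>\<^sup>2 + 9 / 5) \<le> exp ((1 - 9 / 5 * A * ln (real s)) * \<Lambda>)"
    unfolding x_def by (rule est(3)[OF big])
  also have "\<dots> = exp \<Lambda> / exp (9 / 5 * A * ln (real s) * \<Lambda>)"
    by (simp add: left_diff_distrib exp_diff)
  also have "\<dots> \<le> exp \<Lambda> / real s ^ l" using sl s0 by (intro divide_left_mono) auto
  also have "exp \<Lambda> = real s * real m * real R" unfolding \<Lambda>_def using Y0 by simp
  finally have "2 * real s * x\<^sup>2 * (9 / 5 * A * \<Lambda>\<^sup>2 + 9 / 5) \<le> real s * (real m * real R / real s ^ l)"
    by (simp add: mult_ac)
  then have "real s * (2 * x\<^sup>2 * (9 / 5 * A * \<Lambda>\<^sup>2 + 9 / 5)) \<le> real s * (real m * real R / real s ^ l)"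
    by (simp only: mult_ac)
  then have "2 * x\<^sup>2 * (9 / 5 * A * \<Lambda>\<^sup>2 + 9 / 5) \<le> real m * real R / real s ^ l"
    by (rule mult_left_le_imp_le) (use s0 in simp)
  then have "9 / 5 * A * \<Lambda>\<^sup>2 + 9 / 5 \<le> real m * real R / real s ^ l / (2 * x\<^sup>2)"
    using pos_le_divide_eq[OF x2] by (simp only: mult_ac)
  also have "\<dots> \<le> real m * real R / real s ^ l / (2 * real l ^ 2)"
    using lx l0 s0 by (intro divide_left_mono mult_left_mono power_mono mult_pos_pos) auto
  also have "\<dots> = real R * (real m / 2) / (real l ^ 2 * real s ^ l)" by (simp add: mult_ac)
  also have "\<dots> \<le> X"
    unfolding X_def using b s0 by (intro divide_right_mono mult_left_mono) auto
  finally have X: "9 / 5 * A * \<Lambda>\<^sup>2 + 9 / 5 \<le> X" .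
  have "real n \<le> real s * real m * real R"
  proof -
    have "3 / 2 * real m * 1 \<le> real s * real m * real R"
      using s R by (intro mult_mono) auto
    then show ?thesis using n32 by linarith
  qed
  then have "ln (real n) \<le> \<Lambda>" unfolding \<Lambda>_def using n32 m by (intro ln_mono) auto
  then have "real l * ln (real n) \<le> x * \<Lambda>" using lx \<Lambda>0 n32 m by (intro mult_mono) auto
  also have "\<dots> = 9 / 5 * A * \<Lambda>\<^sup>2" by (simp add: x_def power2_eq_square)
  \<comment> \<open>The part \<open>x * \<Lambda>\<close> of the exponent pays for the at most
    \<open>n ^ l\<close> sets of the union bound, the remaining 9/5 for the failure
    probability.\<close>
  finally have "real l * ln (real n) - X \<le> - ln 6" using X ln_six_le by linarith
  then have "exp (real l * ln (real n) + - X) \<le> exp (- ln 6)"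
    unfolding exp_le_cancel_iff by simp
  moreover have "exp (real l * ln (real n)) = real n ^ l"
    using n32 m by (simp add: exp_of_nat_mult)
  moreover have "exp (- ln 6) = (1 / 6 :: real)" by (simp add: exp_minus)
  ultimately have p: "real n ^ l * exp (- X) \<le> 1 / 6" by (simp only: exp_add)
  have "A * \<Lambda> / real m = x * (5 / 6) / (3 / 2 * real m)" by (simp add: x_def)
  also have "\<dots> \<le> (real l + 1) * (1 - real n ^ l * exp (- X)) / real n"
    using lx(2) p n32 x1 m by (intro frac_le mult_mono) auto
  finally have "A * \<Lambda> / real m \<le> (real l + 1) / real n * (1 - real n ^ l * exp (- X))" by simp
  then show ?thesis using that[OF l0 lm ln n] unfolding X_def by blast
qed

text \<open>The threshold \<open>1 + 1 / s\<close> is the number of reads guaranteed by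
  \<open>cost_ge_two_reads\<close>. Beyond it the logarithm is at least 8.9, where the numerical
  estimates for certificates apply.\<close>

lemma Phi_aver_ge_rate:
  assumes s: "CARD('a::finite) \<ge> 2" and m: "m \<ge> 2" and R: "1 \<le> r m" "r m \<le> CARD('a) ^ m"
  shows "ln (real CARD('a)) * (rate_const CARD('a) *
      (1 / real m * ln (real CARD('a) * real m * real (r m)))) \<le> Phi_aver TYPE('a) r"
proof -
  let ?s = "CARD('a)"
  let ?\<Lambda> = "ln (real ?s * real m * real (r m))"
  show ?thesis
  proof (cases "1 + 1 / real ?s < rate_const ?s * ?\<Lambda>")
    case True
    obtain l b n where p: "0 < l" "l < m" "l \<le> n" "n + 1 = m + b"
      "rate_const ?s * ?\<Lambda> / real m \<le> (real l + 1) / real n *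
        (1 - real n ^ l * exp (- (real (r m) * real b / (real l ^ 2 * real ?s ^ l))))"
      by (rule certificate_parameters_exist[OF s m R True])
    have "ln (real ?s) * (rate_const ?s * (1 / real m * ?\<Lambda>)) = ln (real ?s) * (rate_const ?s * ?\<Lambda> / real m)"
      by simp
    also have "\<dots> \<le> ln (real ?s) * ((real l + 1) / real n *
        (1 - real n ^ l * exp (- (real (r m) * real b / (real l ^ 2 * real ?s ^ l)))))"
      using p(5) by (intro mult_left_mono) auto
    also have "\<dots> \<le> Phi_aver TYPE('a) r" using Phi_aver_ge_union_bound[OF s p(1-4)] .
    finally show ?thesis .
  next
    case False
    have "ln (real ?s) * (rate_const ?s * (1 / real m * ?\<Lambda>)) = ln (real ?s) * (rate_const ?s * ?\<Lambda> / real m)"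
      by simp
    also have "\<dots> \<le> ln (real ?s) * ((1 + 1 / real ?s) / real m)"
      using False by (intro mult_left_mono divide_right_mono) auto
    also have "\<dots> \<le> Phi_aver TYPE('a) r" using s m R(1) by (rule Phi_aver_ge_first_reads)
    finally show ?thesis .
  qed
qed

lemma Phi_aver_lower_bound:
  assumes s: "CARD('a::finite) \<ge> 2" and r: "r 0 = 0" "\<And>m. r m \<le> CARD('a) ^ m" "\<exists>m. r m > 0"
    and M: "m_min r \<ge> 2"
  shows "1 / kappa CARD('a) * (phi CARD('a) r + 1 / (2 * real CARD('a) * real (m_min r)))
    \<le> Phi_aver TYPE('a) r"
proof -
  let ?s = "CARD('a)" and ?M = "m_min r"
  let ?S = "real ?s" and ?\<phi> = "phi CARD('a) r"
  note rM = m_min_props(1)[OF r(3)] and minM = m_min_props(2)[OF r(3)]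
  have L: "ln ?S > 0" using s by simp
  have A: "rate_const ?s > 0" by (rule rate_const_estimates(1)[OF s])
  have "?\<phi> \<le> Phi_aver TYPE('a) r / (ln ?S * rate_const ?s)"
    unfolding phi_def
  proof (rule cSUP_least)
    show "{m. r m \<ge> 1} \<noteq> {}" using rM by blast
    fix m assume "m \<in> {m. r m \<ge> 1}"
    then have m: "r m \<ge> 1" "m \<ge> 2" using minM[of m] M by auto
    show "1 / real m * ln (?S * real m * real (r m)) \<le> Phi_aver TYPE('a) r / (ln ?S * rate_const ?s)"
      using Phi_aver_ge_rate[of m r, OF s m(2,1) r(2)] L A
      by (subst le_divide_eq) (auto simp: mult_ac)
  qed
  then have main: "ln ?S * rate_const ?s * ?\<phi> \<le> Phi_aver TYPE('a) r"
    using L A by (simp add: le_divide_eq mult_ac)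
  have ln2s: "ln (2 * ?S) > 0" using s by simp
  have "ln (2 * ?S) \<le> ln (?S * real ?M * real (r ?M))"
  proof (rule ln_mono)
    have "?S * 2 * 1 \<le> ?S * real ?M * real (r ?M)" using M rM by (intro mult_mono) auto
    then show "2 * ?S \<le> ?S * real ?M * real (r ?M)" by simp
  qed (use s in auto)
  then have "1 / real ?M * ln (2 * ?S) \<le> 1 / real ?M * ln (?S * real ?M * real (r ?M))"
    by (intro mult_left_mono) auto
  also have "\<dots> \<le> ?\<phi>" by (rule phi_upper[OF s r(1,2) rM])
  finally have "1 / real ?M \<le> ?\<phi> / ln (2 * ?S)" using ln2s by (simp add: le_divide_eq)
  then have "1 / real ?M / (2 * ?S) \<le> ?\<phi> / ln (2 * ?S) / (2 * ?S)" by (rule divide_right_mono) simp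
  then have "?\<phi> + 1 / (2 * ?S * real ?M) \<le> (1 + 1 / (2 * ?S * ln (2 * ?S))) * ?\<phi>"
    by (simp add: algebra_simps)
  then have "ln ?S / (5 * sqrt ?S) * (?\<phi> + 1 / (2 * ?S * real ?M))
      \<le> ln ?S / (5 * sqrt ?S) * ((1 + 1 / (2 * ?S * ln (2 * ?S))) * ?\<phi>)"
    using L by (intro mult_left_mono) auto
  also have "\<dots> = ln ?S * rate_const ?s * ?\<phi>" by (simp add: rate_const_def)
  also note main
  finally show ?thesis by (simp add: kappa_def)
qed

theorem theorem1:
  fixes s :: nat and r :: "nat \<Rightarrow> nat"
  assumes "s = CARD('a::finite)"
    and "s \<ge> 2"
    and "r 0 = 0"
    and "\<And>m. r m \<le> s ^ m"
    and "\<exists>m. r m > 0"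
    and "m_min r \<ge> 2"
  shows "1 / kappa s * (phi s r + 1 / (2 * real s * real (m_min r))) \<le> Phi_aver TYPE('a) r
    \<and> Phi_aver TYPE('a) r \<le> Phi_max TYPE('a) r
    \<and> Phi_max TYPE('a) r \<le> 2 * (phi s r + 1 / (2 * real s * real (m_min r)))"
proof (intro conjI)
  have s: "CARD('a) \<ge> 2" and r: "\<And>m. r m \<le> CARD('a) ^ m" using assms(1,2,4) by auto
  show "1 / kappa s * (phi s r + 1 / (2 * real s * real (m_min r))) \<le> Phi_aver TYPE('a) r"
    unfolding assms(1) by (rule Phi_aver_lower_bound[OF s assms(3) r assms(5,6)])
  show "Phi_aver TYPE('a) r \<le> Phi_max TYPE('a) r"
    by (rule Phi_aver_le_Phi_max[OF r assms(3)])
  show "Phi_max TYPE('a) r \<le> 2 * (phi s r + 1 / (2 * real s * real (m_min r)))"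
    unfolding Phi_max_def
  proof (rule cSUP_least)
    \<comment> \<open>Padding the empty dictionary shows that the supremum runs over a nonempty
      set.\<close>
    have "content ({} :: 'a list set) m \<le> r m" for m by (simp add: content_def)
    then obtain D :: "'a list set" where "dictionary D" "content D = r"
      using dictionary_extension[OF _ r assms(3)] by metis
    then show "{D :: 'a list set. dictionary D \<and> content D = r} \<noteq> {}" by blast
    fix D :: "'a list set" assume "D \<in> {D. dictionary D \<and> content D = r}"
    then have "Phi D \<le> 2 * phi CARD('a) r + 1 / (real CARD('a) * real (m_min r))"
      using Phi_le_phi[OF s _ assms(3) r assms(5,6)] by blast
    then show "Phi D \<le> 2 * (phi s r + 1 / (2 * real s * real (m_min r)))"
      unfolding assms(1) by (simp add: distrib_left)
  qed
qed

end
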